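(* Let $n \geq 1$ and write $n = 3^k t$ with integers $k \geq 0$, $t > 0$ and $3 \nmid t$. Then the following hold: (i) The minimum degree of $\mathcal{P}_e(U_{6n})$ is $$\delta(\mathcal{P}_e(U_{6n})) = \begin{cases} 2t-1 & \text{if } k = 0,\\ 3t-1 & \text{if } k > 0. \end{cases}$$ (ii) The independence number of $\mathcal{P}_e(U_{6n})$ is $2k+4$. (iii) For $n > 1$, the matching number $\alpha'(\mathcal{P}_e(U_{6n}))$ is $3n$, and $\alpha'(\mathcal{P}_e(U_6)) = 2$. (iv) The strong metric dimension of $\mathcal{P}_e(U_{6n})$ is $6n-k-2$.
   Context: For $n \geq 1$, $U_{6n} = \langle a, b : a^{2n} = b^3 = e,\ ba = ab^{-1} \rangle$, a group of order $6n$. The enhanced power graph $\mathcal{P}_e(G)$ of a group $G$ is the simple undirected graph with vertex set $G$ in which two distinct vertices are adjacent if and only if they belong to a common cyclic subgroup of $G$. The independence number is the largest cardinality of a set of pairwise non-adjacent vertices; the matching number $\alpha'$ is the maximum cardinality of a set of edges no two of which share an endpoint. For vertices $u,v$ of a graph $\Gamma$, a vertex $z$ strongly resolves $u$ and $v$ if there is a shortest path from $z$ to $u$ containing $v$, or a shortest path from $z$ to $v$ containing $u$; a strong resolving set is a set $U$ of vertices such that every pair of (distinct) vertices of $\Gamma$ is strongly resolved by some vertex of $U$; the strong metric dimension is the least cardinality of a strong resolving set. *)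

theory Defs
  imports
    "HOL-Algebra.Elementary_Groups"
    "Graph_Theory.Pair_Digraph"
    "Graph_Theory.Vertex_Walk"
begin

section \<open>Groups given by generators and relations\<close>

text \<open>
  A word over the generators \<open>'g\<close> and their formal inverses: the letter \<open>(g, True)\<close> stands
  for \<open>g\<close> and \<open>(g, False)\<close> for its inverse. A relation \<open>l = r\<close> is the pair of words \<open>(l, r)\<close>.
\<close>

type_synonym 'g gword = "('g \<times> bool) list"

text \<open>The least congruence on words containing the relations and the free cancellations.\<close>

inductive word_eq :: "('g gword \<times> 'g gword) set \<Rightarrow> 'g gword \<Rightarrow> 'g gword \<Rightarrow> bool"
  for R where
  refl: "word_eq R u u"
| sym: "word_eq R u v \<Longrightarrow> word_eq R v u"
| trans: "word_eq R u v \<Longrightarrow> word_eq R v w \<Longrightarrow> word_eq R u w"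
| cancel: "word_eq R (u @ [(g, s), (g, \<not> s)] @ v) (u @ v)"
| relation: "(l, r) \<in> R \<Longrightarrow> word_eq R (u @ l @ v) (u @ r @ v)"

definition word_rel :: "('g gword \<times> 'g gword) set \<Rightarrow> 'g gword rel" where
  "word_rel R = {(u, v). word_eq R u v}"

definition presented_group :: "('g gword \<times> 'g gword) set \<Rightarrow> 'g gword set monoid" where
  "presented_group R =
     \<lparr>carrier = UNIV // word_rel R,
      monoid.mult = (\<lambda>X Y. \<Union>u\<in>X. \<Union>v\<in>Y. word_rel R `` {u @ v}),
      one = word_rel R `` {[]}\<rparr>"

lemma equiv_word_rel: "equiv UNIV (word_rel R)"
  by (rule equivI) (auto simp: word_rel_def refl_on_def sym_def trans_def intro: word_eq.intros)

lemma word_eq_append_left: "word_eq R u v \<Longrightarrow> word_eq R (w @ u) (w @ v)"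
proof (induction rule: word_eq.induct)
  case (cancel u g s v)
  show ?case using word_eq.cancel[of R "w @ u" g s v] by simp
next
  case (relation l r u v)
  then show ?case using word_eq.relation[of l r R "w @ u" v] by simp
qed (auto intro: word_eq.intros)

lemma word_eq_append_right: "word_eq R u v \<Longrightarrow> word_eq R (u @ w) (v @ w)"
proof (induction rule: word_eq.induct)
  case (cancel u g s v)
  show ?case using word_eq.cancel[of R u g s "v @ w"] by simp
next
  case (relation l r u v)
  then show ?case using word_eq.relation[of l r R u "v @ w"] by simp
qed (auto intro: word_eq.intros)

lemma word_eq_append: "word_eq R u u' \<Longrightarrow> word_eq R v v' \<Longrightarrow> word_eq R (u @ v) (u' @ v')"
  by (meson word_eq.trans word_eq_append_left word_eq_append_right)

lemma presented_group_mult: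
  "word_rel R `` {u} \<otimes>\<^bsub>presented_group R\<^esub> word_rel R `` {v} = word_rel R `` {u @ v}"
proof -
  have "(\<lambda>u v. word_rel R `` {u @ v}) respects2 word_rel R"
    by (rule congruent2I', rule equiv_class_eq[OF equiv_word_rel])
       (auto simp: word_rel_def intro: word_eq_append)
  from UN_equiv_class2[OF equiv_word_rel equiv_word_rel this, of u v]
  show ?thesis by (simp add: presented_group_def)
qed

lemma word_eq_inverse:
  "word_eq R (rev (map (\<lambda>(g, s). (g, \<not> s)) u) @ u) []"
proof (induction u)
  case (Cons x u)
  obtain g s where x: "x = (g, s)" by (cases x)
  let ?i = "rev (map (\<lambda>(g, s). (g, \<not> s)) u)"
  have "word_eq R (?i @ [(g, \<not> s), (g, s)] @ u) (?i @ u)"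
    using word_eq.cancel[of R ?i g "\<not> s" u] by simp
  from word_eq.trans[OF this Cons.IH] show ?case by (simp add: x)
qed (simp add: word_eq.refl)

lemma group_presented_group: "group (presented_group R)"
proof (rule groupI)
  show "\<one>\<^bsub>presented_group R\<^esub> \<in> carrier (presented_group R)"
    by (simp add: presented_group_def quotientI)
next
  fix x y assume "x \<in> carrier (presented_group R)" "y \<in> carrier (presented_group R)"
  then obtain u v where "x = word_rel R `` {u}" "y = word_rel R `` {v}"
    by (auto simp: presented_group_def elim!: quotientE)
  then show "x \<otimes>\<^bsub>presented_group R\<^esub> y \<in> carrier (presented_group R)"
    by (simp add: presented_group_mult) (simp add: presented_group_def quotientI)
next
  fix x y z
  assume "x \<in> carrier (presented_group R)" "y \<in> carrier (presented_group R)"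
    "z \<in> carrier (presented_group R)"
  then obtain u v w
    where "x = word_rel R `` {u}" "y = word_rel R `` {v}" "z = word_rel R `` {w}"
    by (auto simp: presented_group_def elim!: quotientE)
  then show "x \<otimes>\<^bsub>presented_group R\<^esub> y \<otimes>\<^bsub>presented_group R\<^esub> z =
      x \<otimes>\<^bsub>presented_group R\<^esub> (y \<otimes>\<^bsub>presented_group R\<^esub> z)"
    by (simp add: presented_group_mult)
next
  fix x assume "x \<in> carrier (presented_group R)"
  then obtain u where x: "x = word_rel R `` {u}"
    by (auto simp: presented_group_def elim!: quotientE)
  have one: "\<one>\<^bsub>presented_group R\<^esub> = word_rel R `` {[]}"
    by (simp add: presented_group_def)
  show "\<one>\<^bsub>presented_group R\<^esub> \<otimes>\<^bsub>presented_group R\<^esub> x = x"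
    by (simp add: x one presented_group_mult)
  let ?y = "word_rel R `` {rev (map (\<lambda>(g, s). (g, \<not> s)) u)}"
  have "?y \<in> carrier (presented_group R)"
    by (simp add: presented_group_def quotientI)
  moreover have "?y \<otimes>\<^bsub>presented_group R\<^esub> x = \<one>\<^bsub>presented_group R\<^esub>"
    unfolding x one presented_group_mult
    by (rule equiv_class_eq[OF equiv_word_rel]) (simp add: word_rel_def word_eq_inverse)
  ultimately show "\<exists>y\<in>carrier (presented_group R).
      y \<otimes>\<^bsub>presented_group R\<^esub> x = \<one>\<^bsub>presented_group R\<^esub>" ..
qed

section \<open>The group \<open>U\<^sub>6\<^sub>n\<close>\<close>

datatype U6n_gen = Gen_a | Gen_b

text \<open>The relations are \<open>a\<^sup>2\<^sup>n = e\<close>, \<open>b\<^sup>3 = e\<close> and \<open>b a = a b\<^sup>-\<^sup>1\<close>. The argument is \<open>n\<close>, not \<open>6n\<close>.\<close>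

definition U6n :: "nat \<Rightarrow> U6n_gen gword set monoid" where
  "U6n n = presented_group
     {(replicate (2 * n) (Gen_a, True), []),
      (replicate 3 (Gen_b, True), []),
      ([(Gen_b, True), (Gen_a, True)], [(Gen_a, True), (Gen_b, False)])}"

section \<open>Graph invariants\<close>

text \<open>
  As in the session \<open>Graph_Theory\<close>, a simple undirected graph is a loopless symmetric digraph
  without parallel arcs. Hence the degree of a vertex is its \<^const>\<open>out_degree\<close>, and the two
  opposite arcs between adjacent vertices form a single edge. All invariants below are meant
  for finite graphs.
\<close>

definition min_degree :: "('a, 'b) pre_digraph \<Rightarrow> nat" where
  "min_degree G = Min (out_degree G ` verts G)"

definition independent_set :: "('a, 'b) pre_digraph \<Rightarrow> 'a set \<Rightarrow> bool" where
  "independent_set G S \<longleftrightarrow> S \<subseteq> verts G \<and> pairwise (\<lambda>u v. \<not> u \<rightarrow>\<^bsub>G\<^esub> v) S"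

definition independence_number :: "('a, 'b) pre_digraph \<Rightarrow> nat" where
  "independence_number G = Max (card ` {S. independent_set G S})"

definition undirected_edges :: "('a, 'b) pre_digraph \<Rightarrow> 'a set set" where
  "undirected_edges G = {{u, v} | u v. u \<rightarrow>\<^bsub>G\<^esub> v}"

definition matching :: "('a, 'b) pre_digraph \<Rightarrow> 'a set set \<Rightarrow> bool" where
  "matching G M \<longleftrightarrow> M \<subseteq> undirected_edges G \<and> pairwise disjnt M"

definition matching_number :: "('a, 'b) pre_digraph \<Rightarrow> nat" where
  "matching_number G = Max (card ` {M. matching G M})"

definition path_between :: "('a, 'b) pre_digraph \<Rightarrow> 'a \<Rightarrow> 'a list \<Rightarrow> 'a \<Rightarrow> bool" where
  "path_between G u p v \<longleftrightarrow> vpath p G \<and> hd p = u \<and> last p = v"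

definition shortest_path :: "('a, 'b) pre_digraph \<Rightarrow> 'a \<Rightarrow> 'a list \<Rightarrow> 'a \<Rightarrow> bool" where
  "shortest_path G u p v \<longleftrightarrow> path_between G u p v \<and>
     (\<forall>q. path_between G u q v \<longrightarrow> vwalk_length p \<le> vwalk_length q)"

definition strongly_resolves :: "('a, 'b) pre_digraph \<Rightarrow> 'a \<Rightarrow> 'a \<Rightarrow> 'a \<Rightarrow> bool" where
  "strongly_resolves G z u v \<longleftrightarrow>
     (\<exists>p. shortest_path G z p u \<and> v \<in> set p) \<or> (\<exists>p. shortest_path G z p v \<and> u \<in> set p)"

definition strong_resolving_set :: "('a, 'b) pre_digraph \<Rightarrow> 'a set \<Rightarrow> bool" where
  "strong_resolving_set G U \<longleftrightarrow> U \<subseteq> verts G \<and>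
     (\<forall>u\<in>verts G. \<forall>v\<in>verts G. u \<noteq> v \<longrightarrow> (\<exists>z\<in>U. strongly_resolves G z u v))"

definition strong_metric_dimension :: "('a, 'b) pre_digraph \<Rightarrow> nat" where
  "strong_metric_dimension G = Min (card ` {U. strong_resolving_set G U})"

section \<open>The enhanced power graph\<close>

definition enhanced_power_graph :: "('a, 'm) monoid_scheme \<Rightarrow> 'a pair_pre_digraph" where
  "enhanced_power_graph G =
     \<lparr>pverts = carrier G,
      parcs = {(x, y). x \<noteq> y \<and>
        (\<exists>H. subgroup H G \<and> cyclic_group (G\<lparr>carrier := H\<rparr>) \<and> x \<in> H \<and> y \<in> H)}\<rparr>"

lemma pair_graph_enhanced_power_graph:
  assumes "finite (carrier G)"
  shows "pair_graph (enhanced_power_graph G)"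
proof
  have sub: "parcs (enhanced_power_graph G) \<subseteq> carrier G \<times> carrier G"
    by (auto simp: enhanced_power_graph_def dest: subgroup.subset)
  then show "finite (parcs (enhanced_power_graph G))"
    using assms by (meson finite_SigmaI finite_subset)
  fix e assume "e \<in> parcs (enhanced_power_graph G)"
  with sub show "fst e \<in> pverts (enhanced_power_graph G)" "snd e \<in> pverts (enhanced_power_graph G)"
    by (auto simp: enhanced_power_graph_def)
qed (use assms in \<open>auto simp: enhanced_power_graph_def symmetric_def sym_def\<close>)

end

theory Submission
  imports Defs "HOL-Number_Theory.Cong"
begin

text \<open>
  Every element of \<open>U\<^sub>6\<^sub>n\<close> is \<open>a\<^sup>i b\<^sup>j\<close> with \<open>i\<close> modulo \<open>2n\<close> and \<open>j\<close> modulo \<open>3\<close>. The maximal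
  cyclic subgroups are the three subgroups generated by \<open>a b\<^sup>h\<close>, which meet in the centre
  \<open>\<langle>a\<^sup>2\<rangle>\<close>, and \<open>2k + 1\<close> further ones in the abelian subgroup \<open>\<langle>a\<^sup>2\<rangle> \<times> \<langle>b\<rangle>\<close>.
  An element outside the centre lies in exactly one of them, so that its closed neighbourhood is
  this subgroup. Hence the minimum degree is one less than the least order of a maximal
  cyclic subgroup, and the independence number is the number of these subgroups.

  As the graph has diameter at most \<open>2\<close>, a set is strongly resolving iff its complement is a clique
  whose members have pairwise distinct closed neighbourhoods. Such a clique has at most one vertex
  outside the centre, and the central elements have \<open>k + 1\<close> different closed neighbourhoods,
  determined by the power of \<open>3\<close> that divides the exponent of \<open>a\<close>.

  A perfect matching for \<open>n > 1\<close> pairs \<open>x\<close> with its inverse, up to a correction at the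
  elements of order at most \<open>2\<close>, which are their own inverses.
\<close>

section \<open>Graphs covered by cliques\<close>

text \<open>
  Only the vertices in \<open>K\<close> lie in more than one clique. The closed neighbourhood of any other
  vertex is therefore one of the cliques.
\<close>

locale clique_cover =
  fixes \<Gamma> :: "'a pair_pre_digraph" and C :: "'c set" and M :: "'c \<Rightarrow> 'a set" and K :: "'a set"
    and e :: 'a and c0 :: 'c
  assumes finite_verts: "finite (pverts \<Gamma>)" and finite_C: "finite C"
    and parcs_eq: "parcs \<Gamma> = {(x, y). x \<noteq> y \<and> (\<exists>c\<in>C. x \<in> M c \<and> y \<in> M c)}"
    and UN_M: "(\<Union>c\<in>C. M c) = pverts \<Gamma>"
    and unique: "\<lbrakk>c \<in> C; d \<in> C; x \<in> M c; x \<in> M d; x \<notin> K\<rbrakk> \<Longrightarrow> c = d"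
    and has_private: "c \<in> C \<Longrightarrow> \<exists>x\<in>M c. x \<notin> K"
    and e_in_M: "c \<in> C \<Longrightarrow> e \<in> M c"
    and c0: "c0 \<in> C" and K_subset: "K \<subseteq> M c0"
    and K_not_private: "x \<in> K \<Longrightarrow> \<exists>c\<in>C. c \<noteq> c0 \<and> x \<in> M c"
begin

section \<open>Closed neighbourhoods and private vertices\<close>

definition cliques_at :: "'a \<Rightarrow> 'c set" where
  "cliques_at x = {c \<in> C. x \<in> M c}"

definition nbh :: "'a \<Rightarrow> 'a set" where
  "nbh x = (\<Union>c\<in>cliques_at x. M c)"

text \<open>Since \<open>unique\<close> confines a vertex outside \<open>K\<close> to one clique,
  \<open>priv c\<close> identifies the clique \<open>c\<close>; its closed neighbourhood is
  \<open>M c\<close>.\<close>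

definition priv :: "'c \<Rightarrow> 'a" where
  "priv c = (SOME x. x \<in> M c \<and> x \<notin> K)"

lemma priv: "c \<in> C \<Longrightarrow> priv c \<in> M c" "c \<in> C \<Longrightarrow> priv c \<notin> K"
  using has_private[of c] unfolding priv_def by (metis (mono_tags, lifting) someI)+

lemma M_subset: "c \<in> C \<Longrightarrow> M c \<subseteq> pverts \<Gamma>"
  using UN_M by auto

lemma finite_M: "c \<in> C \<Longrightarrow> finite (M c)"
  using M_subset finite_verts finite_subset by metis

lemma in_M_iff: "c \<in> C \<Longrightarrow> d \<in> C \<Longrightarrow> priv c \<in> M d \<longleftrightarrow> c = d"
  using priv unique by metis

lemma cliques_at_priv: "c \<in> C \<Longrightarrow> cliques_at (priv c) = {c}"
  using in_M_iff by (auto simp: cliques_at_def)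

lemma nbh_subset: "nbh x \<subseteq> pverts \<Gamma>"
  using M_subset by (auto simp: nbh_def cliques_at_def)

lemma in_nbh_iff: "y \<in> nbh x \<longleftrightarrow> (\<exists>c\<in>C. x \<in> M c \<and> y \<in> M c)"
  by (auto simp: nbh_def cliques_at_def)

lemma nbh_sym: "y \<in> nbh x \<longleftrightarrow> x \<in> nbh y"
  by (auto simp: in_nbh_iff)

lemma self_in_nbh: "x \<in> pverts \<Gamma> \<Longrightarrow> x \<in> nbh x"
  using UN_M by (auto simp: in_nbh_iff)

lemma dominates_iff: "x \<rightarrow>\<^bsub>with_proj \<Gamma>\<^esub> y \<longleftrightarrow> x \<noteq> y \<and> y \<in> nbh x"
  by (simp add: parcs_eq in_nbh_iff)

lemma e_in_nbh: "x \<in> pverts \<Gamma> \<Longrightarrow> e \<in> nbh x"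
  using UN_M e_in_M by (auto simp: in_nbh_iff)

text \<open>Private vertices recover the cliques: for \<open>c\<close> in \<open>C\<close>,
  \<open>priv c\<close> lies in \<open>nbh z\<close> exactly when \<open>z\<close> lies in
  \<open>M c\<close>. Twins, that is vertices with equal closed neighbourhoods, are thus detected by
  \<open>cliques_at\<close>.\<close>

lemma cliques_at_eq_iff: "cliques_at x = cliques_at y \<longleftrightarrow> nbh x = nbh y"
proof
  assume "nbh x = nbh y"
  moreover have "cliques_at z = {c \<in> C. priv c \<in> nbh z}" for z
    using in_M_iff priv(1) by (auto simp: cliques_at_def in_nbh_iff)
  ultimately show "cliques_at x = cliques_at y" by simp
qed (simp add: nbh_def)

text \<open>Each closed neighbourhood contains a clique, and that of a private vertex is a clique.
  The subtracted 1 accounts for the vertex itself.\<close>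

lemma min_degree_eq: "min_degree (with_proj \<Gamma>) = Min ((\<lambda>c. card (M c)) ` C) - 1"
proof -
  have deg: "out_degree (with_proj \<Gamma>) x = card (nbh x) - 1" if "x \<in> pverts \<Gamma>" for x
  proof -
    have "out_arcs (with_proj \<Gamma>) x = Pair x ` (nbh x - {x})"
      by (auto simp: out_arcs_def parcs_eq in_nbh_iff image_iff)
    then show ?thesis
      using self_in_nbh[OF that] by (simp add: out_degree_def card_image inj_on_def card_Diff_singleton)
  qed
  let ?m = "Min ((\<lambda>c. card (M c)) ` C)"
  have "?m \<in> (\<lambda>c. card (M c)) ` C"
    using c0 finite_C by (intro Min_in) auto
  then obtain c where c: "c \<in> C" "card (M c) = ?m" by auto
  show ?thesis unfolding min_degree_def
  proof (rule Min_eqI)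
    show "finite (out_degree (with_proj \<Gamma>) ` verts (with_proj \<Gamma>))"
      using finite_verts by simp
  next
    fix d assume "d \<in> out_degree (with_proj \<Gamma>) ` verts (with_proj \<Gamma>)"
    then obtain x where x: "x \<in> pverts \<Gamma>" "d = card (nbh x) - 1"
      using deg by auto
    then obtain c' where c': "c' \<in> C" "x \<in> M c'"
      using UN_M by auto
    then have "M c' \<subseteq> nbh x" by (auto simp: in_nbh_iff)
    then have "card (M c') \<le> card (nbh x)"
      using nbh_subset finite_verts card_mono finite_subset by metis
    moreover have "?m \<le> card (M c')"
      using finite_C c' by (intro Min_le) auto
    ultimately show "?m - 1 \<le> d" using x by simp
  next
    have "priv c \<in> pverts \<Gamma>"
      using c(1) priv(1) M_subset by blast
    moreover have "nbh (priv c) = M c"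
      by (simp add: nbh_def cliques_at_priv c)
    ultimately show "?m - 1 \<in> out_degree (with_proj \<Gamma>) ` verts (with_proj \<Gamma>)"
      using deg c(2) by (intro rev_image_eqI[of "priv c"]) auto
  qed
qed

text \<open>An independent set has at most one vertex in each clique, and the private vertices of
  all cliques are independent.\<close>

lemma independence_number_eq: "independence_number (with_proj \<Gamma>) = card C"
  unfolding independence_number_def
proof (rule Max_eqI)
  have "{S. independent_set (with_proj \<Gamma>) S} \<subseteq> Pow (pverts \<Gamma>)"
    by (auto simp: independent_set_def)
  then show "finite (card ` {S. independent_set (with_proj \<Gamma>) S})"
    using finite_verts finite_subset by blast
next
  fix m assume "m \<in> card ` {S. independent_set (with_proj \<Gamma>) S}"
  then obtain S where S: "S \<subseteq> pverts \<Gamma>" "m = card S"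
      "\<And>x y. x \<in> S \<Longrightarrow> y \<in> S \<Longrightarrow> y \<in> nbh x \<Longrightarrow> x = y"
    unfolding independent_set_def pairwise_def dominates_iff by auto
  have "\<forall>x\<in>S. \<exists>c. c \<in> C \<and> x \<in> M c"
    using S(1) UN_M by auto
  then obtain f where f: "\<And>x. x \<in> S \<Longrightarrow> f x \<in> C" "\<And>x. x \<in> S \<Longrightarrow> x \<in> M (f x)"
    by metis
  have "inj_on f S"
  proof
    fix x y assume *: "x \<in> S" "y \<in> S" "f x = f y"
    then have "y \<in> nbh x"
      using f in_nbh_iff by metis
    then show "x = y" using * S(3) by blast
  qed
  then show "m \<le> card C"
    using S(2) f(1) finite_C card_inj_on_le by (metis image_subsetI)
next
  have "independent_set (with_proj \<Gamma>) (priv ` C)"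
    unfolding independent_set_def pairwise_def dominates_iff
    using priv(1) M_subset in_M_iff by (force simp: in_nbh_iff)
  moreover have "inj_on priv C"
    using in_M_iff priv(1) by (metis inj_onI)
  ultimately show "card C \<in> card ` {S. independent_set (with_proj \<Gamma>) S}"
    by (metis card_image image_eqI mem_Collect_eq)
qed

section \<open>Matchings and the vertices they cover\<close>

lemma undirected_edges_eq:
  "undirected_edges (with_proj \<Gamma>) = {{x, y} |x y. x \<noteq> y \<and> y \<in> nbh x}"
  unfolding undirected_edges_def dominates_iff ..

text \<open>The edges of a matching partition the covered vertices into sets of size two.\<close>

lemma matching_Union:
  assumes "matching (with_proj \<Gamma>) A"
  shows "finite A" "\<Union>A \<subseteq> pverts \<Gamma>" "2 * card A = card (\<Union>A)"
proof -
  have A: "A \<subseteq> {{x, y} |x y. x \<noteq> y \<and> y \<in> nbh x}" "pairwise disjnt A"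
    using assms unfolding matching_def undirected_edges_eq by auto
  show sub: "\<Union>A \<subseteq> pverts \<Gamma>"
    using A(1) nbh_subset nbh_sym by blast
  then show "finite A"
    using finite_verts finite_UnionD finite_subset by metis
  then show "2 * card A = card (\<Union>A)"
    using A finite_subset[OF sub finite_verts]
    by (intro card_partition) (auto simp: pairwise_def disjnt_def)
qed

lemma finite_matchings: "finite {A. matching (with_proj \<Gamma>) A}"
proof (rule finite_subset)
  show "{A. matching (with_proj \<Gamma>) A} \<subseteq> Pow (Pow (pverts \<Gamma>))"
    using matching_Union(2) by blast
qed (simp add: finite_verts)

lemma matching_number_perfect:
  assumes "matching (with_proj \<Gamma>) A" "\<Union>A = pverts \<Gamma>"
  shows "2 * matching_number (with_proj \<Gamma>) = card (pverts \<Gamma>)"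
proof -
  have "matching_number (with_proj \<Gamma>) = card A"
    unfolding matching_number_def
  proof (rule Max_eqI)
    fix m assume "m \<in> card ` {B. matching (with_proj \<Gamma>) B}"
    then obtain B where B: "matching (with_proj \<Gamma>) B" "m = card B" by blast
    have "2 * card B \<le> 2 * card A"
      unfolding matching_Union(3)[OF B(1)] matching_Union(3)[OF assms(1)] assms(2)
      using matching_Union(2)[OF B(1)] finite_verts by (rule card_mono[rotated])
    then show "m \<le> card A" using B(2) by simp
  qed (use finite_matchings assms(1) in auto)
  then show ?thesis
    using matching_Union(3)[OF assms(1)] assms(2) by simp
qed

section \<open>Shortest paths and strong resolution\<close>

lemma path_between_cases:
  assumes "path_between (with_proj \<Gamma>) u p v" "u \<noteq> v"
  obtains "p = [u, v]" "v \<in> nbh u"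
  | z where "p = [u, z, v]" "z \<in> nbh u" "v \<in> nbh z"
  | "length p \<ge> 4"
proof -
  have p: "set (vwalk_arcs p) \<subseteq> parcs \<Gamma>" "hd p = u" "last p = v" "p \<noteq> []"
    using assms(1) by (auto simp: path_between_def vpath_def vwalk_def)
  have step: "y \<in> nbh x" if "(x, y) \<in> parcs \<Gamma>" for x y
    using that by (auto simp: parcs_eq in_nbh_iff)
  consider x where "p = [x]" | x y where "p = [x, y]" | x y z where "p = [x, y, z]"
    | x y z w q where "p = x # y # z # w # q"
    using p(4) by (metis neq_Nil_conv)
  then show thesis
  proof cases
    case 1
    then show ?thesis using p assms(2) by simp
  next
    case (2 x y)
    then show ?thesis using that(1) p step by auto
  next
    case (3 x y z)
    then show ?thesis using that(2)[of y] p step by auto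
  next
    case 4
    then show ?thesis using that(3) by simp
  qed
qed

lemma path_between_edge:
  assumes "v \<in> nbh u" "u \<noteq> v"
  shows "path_between (with_proj \<Gamma>) u [u, v] v"
  using assms M_subset
  by (auto simp: path_between_def vpath_def vwalk_def parcs_eq in_nbh_iff)

lemma path_between_two_edges:
  assumes "z \<in> nbh u" "v \<in> nbh z" "u \<noteq> v" "u \<noteq> z" "z \<noteq> v"
  shows "path_between (with_proj \<Gamma>) u [u, z, v] v"
  using assms M_subset
  by (auto simp: path_between_def vpath_def vwalk_def parcs_eq in_nbh_iff)

lemma shortest_path_edge:
  assumes "v \<in> nbh u" "u \<noteq> v"
  shows "shortest_path (with_proj \<Gamma>) u [u, v] v"
  unfolding shortest_path_def
proof (intro conjI allI impI)
  fix q assume "path_between (with_proj \<Gamma>) u q v"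
  then show "vwalk_length [u, v] \<le> vwalk_length q"
    by (rule path_between_cases) (use assms in auto)
qed (rule path_between_edge[OF assms])

lemma shortest_path_two_edges:
  assumes "z \<in> nbh u" "v \<in> nbh z" "v \<notin> nbh u" "u \<noteq> v"
  shows "shortest_path (with_proj \<Gamma>) u [u, z, v] v"
  unfolding shortest_path_def
proof (intro conjI allI impI)
  show "path_between (with_proj \<Gamma>) u [u, z, v] v"
    using assms by (intro path_between_two_edges) auto
  fix q assume "path_between (with_proj \<Gamma>) u q v"
  then show "vwalk_length [u, z, v] \<le> vwalk_length q"
    by (rule path_between_cases) (use assms in auto)
qed

text \<open>The vertex \<open>e\<close> is adjacent to all others and bounds distances by 2, so a
  shortest path with an inner vertex has only this one and its ends are not adjacent.\<close>

lemma middle_of_shortest_path: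
  assumes "shortest_path (with_proj \<Gamma>) z p u" "v \<in> set p" "v \<noteq> z" "v \<noteq> u" "z \<noteq> u"
    "z \<in> pverts \<Gamma>" "u \<in> pverts \<Gamma>"
  shows "v \<in> nbh z" "v \<in> nbh u" "u \<notin> nbh z"
proof -
  have p: "path_between (with_proj \<Gamma>) z p u"
    and le: "\<And>q. path_between (with_proj \<Gamma>) z q u \<Longrightarrow> length p - 1 \<le> length q - 1"
    using assms(1) by (auto simp: shortest_path_def)
  show "u \<notin> nbh z"
  proof
    assume "u \<in> nbh z"
    then have "length p \<le> 2"
      using le[OF path_between_edge] assms(5) by fastforce
    then show False
      by (rule_tac path_between_cases[OF p assms(5)]) (use assms(2-4) in auto)
  qed
  \<comment> \<open>Otherwise \<open>z\<close> and \<open>u\<close> would be adjacent. Both must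
    differ from \<open>e\<close> for \<open>[z, e, u]\<close> to be a path.\<close>
  then have ze: "z \<noteq> e" "u \<noteq> e"
    using assms(6,7) e_in_nbh nbh_sym by auto
  have "length p - 1 \<le> length [z, e, u] - 1"
    using assms(5,6,7) ze e_in_nbh nbh_sym by (intro le path_between_two_edges) auto
  then obtain y where "p = [z, y, u]" "y \<in> nbh z" "u \<in> nbh y"
    by (rule_tac path_between_cases[OF p assms(5)]) (use assms(2-4) in auto)
  then show "v \<in> nbh z" "v \<in> nbh u"
    using assms(2-4) nbh_sym by auto
qed

text \<open>A path contains its own ends, so only the existence of a shortest path is at stake: an
  edge or a detour through \<open>e\<close>.\<close>

lemma strongly_resolves_self:
  assumes "u \<in> pverts \<Gamma>" "v \<in> pverts \<Gamma>" "u \<noteq> v"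
  shows "strongly_resolves (with_proj \<Gamma>) u u v" "strongly_resolves (with_proj \<Gamma>) v u v"
proof -
  have "\<exists>p. shortest_path (with_proj \<Gamma>) x p y \<and> x \<in> set p"
    if "x \<in> pverts \<Gamma>" "y \<in> pverts \<Gamma>" "x \<noteq> y" for x y
  proof (cases "y \<in> nbh x")
    case True
    then show ?thesis using shortest_path_edge[OF True that(3)] by fastforce
  next
    case False
    then show ?thesis
      using shortest_path_two_edges[of e x y] that e_in_nbh nbh_sym by fastforce
  qed
  then show "strongly_resolves (with_proj \<Gamma>) u u v" "strongly_resolves (with_proj \<Gamma>) v u v"
    using assms unfolding strongly_resolves_def by blast+
qed

text \<open>
  Shortest paths have at most two edges. Hence a vertex other than \<open>u\<close> and \<open>v\<close> strongly resolves
  them iff \<open>u\<close> and \<open>v\<close> are adjacent and it is adjacent to exactly one of them.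
\<close>

lemma strong_resolving_set_iff:
  "strong_resolving_set (with_proj \<Gamma>) U \<longleftrightarrow> U \<subseteq> pverts \<Gamma> \<and>
     (\<forall>u\<in>pverts \<Gamma> - U. \<forall>v\<in>pverts \<Gamma> - U. v \<in> nbh u) \<and> inj_on cliques_at (pverts \<Gamma> - U)"
  (is "?L \<longleftrightarrow> ?R")
proof
  assume L: ?L
  have *: "v \<in> nbh u \<and> cliques_at u \<noteq> cliques_at v" if uv: "u \<in> pverts \<Gamma> - U" "v \<in> pverts \<Gamma> - U" "u \<noteq> v" for u v
  proof -
    obtain z where z: "z \<in> U" "strongly_resolves (with_proj \<Gamma>) z u v"
      using L uv unfolding strong_resolving_set_def with_proj_simps by blast
    then have zv: "z \<noteq> u" "z \<noteq> v" "z \<in> pverts \<Gamma>"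
      using uv L by (auto simp: strong_resolving_set_def)
    from z(2) consider p where "shortest_path (with_proj \<Gamma>) z p u" "v \<in> set p"
      | p where "shortest_path (with_proj \<Gamma>) z p v" "u \<in> set p"
      unfolding strongly_resolves_def by blast
    then show ?thesis
    proof cases
      case 1
      then show ?thesis
        using middle_of_shortest_path[OF 1] zv uv nbh_sym cliques_at_eq_iff by (metis DiffD1)
    next
      case 2
      then show ?thesis
        using middle_of_shortest_path[OF 2] zv uv nbh_sym cliques_at_eq_iff by (metis DiffD1)
    qed
  qed
  have "v \<in> nbh u" if "u \<in> pverts \<Gamma> - U" "v \<in> pverts \<Gamma> - U" for u v
    using *[OF that] self_in_nbh that by (cases "u = v") auto
  moreover have "inj_on cliques_at (pverts \<Gamma> - U)"
    using * by (auto intro!: inj_onI)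
  ultimately show ?R
    using L unfolding strong_resolving_set_def by auto
next
  assume R: ?R
  have res: "\<exists>z\<in>U. strongly_resolves (with_proj \<Gamma>) z u v"
    if uv: "u \<in> pverts \<Gamma>" "v \<in> pverts \<Gamma>" "u \<noteq> v" for u v
  proof (cases "u \<in> U \<or> v \<in> U")
    case True
    then show ?thesis using strongly_resolves_self[OF uv] by blast
  next
    case False
    then have cl: "v \<in> nbh u" "u \<in> nbh v" and "cliques_at u \<noteq> cliques_at v"
      using R uv by (auto dest: inj_onD)
    then consider z where "z \<in> nbh v" "z \<notin> nbh u" | z where "z \<in> nbh u" "z \<notin> nbh v"
      using cliques_at_eq_iff by blast
    then show ?thesis
    proof cases
      case 1
      then have "shortest_path (with_proj \<Gamma>) z [z, v, u] u"
        using cl nbh_sym self_in_nbh uv by (intro shortest_path_two_edges) auto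
      \<comment> \<open>The complement of \<open>U\<close> is a clique containing \<open>u\<close>,
        but \<open>z\<close> is not in \<open>nbh u\<close>.\<close>
      moreover have "z \<in> U"
        using 1 False R uv nbh_subset by blast
      ultimately show ?thesis unfolding strongly_resolves_def by fastforce
    next
      case 2
      then have "shortest_path (with_proj \<Gamma>) z [z, u, v] v"
        using cl nbh_sym self_in_nbh uv by (intro shortest_path_two_edges) auto
      moreover have "z \<in> U"
        using 2 False R uv nbh_subset by blast
      ultimately show ?thesis unfolding strongly_resolves_def by fastforce
    qed
  qed
  then show ?L using R unfolding strong_resolving_set_def by auto
qed

text \<open>Two members outside \<open>K\<close> share a clique, which is the only one for both, so
  they are twins and hence equal. The members in \<open>K\<close> are counted by their values of
  \<open>cliques_at\<close>.\<close>

lemma card_twin_free_clique_le: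
  assumes W: "W \<subseteq> pverts \<Gamma>" "\<And>u v. u \<in> W \<Longrightarrow> v \<in> W \<Longrightarrow> v \<in> nbh u" "inj_on cliques_at W"
  shows "card W \<le> card (cliques_at ` K) + 1"
proof -
  have fin: "finite W" "finite (cliques_at ` K)"
    using W(1) K_subset c0 M_subset finite_verts by (meson finite_subset finite_imageI)+
  have "u = v" if uv: "u \<in> W - K" "v \<in> W - K" for u v
  proof -
    obtain c where "c \<in> C" "u \<in> M c" "v \<in> M c" using W(2) uv by (auto simp: in_nbh_iff)
    then have "cliques_at u = {c}" "cliques_at v = {c}"
      using uv unique by (auto simp: cliques_at_def)
    then show ?thesis using inj_onD[OF W(3), of u v] uv by simp
  qed
  then have "card (W - K) \<le> 1"
    using fin by (auto simp: card_le_Suc0_iff_eq)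
  moreover have "card (W \<inter> K) \<le> card (cliques_at ` K)"
    using W(3) fin by (intro card_inj_on_le[of cliques_at]) (auto intro: inj_on_subset)
  moreover have "card W = card (W \<inter> K) + card (W - K)"
    using fin by (metis card_Un_disjoint Int_Diff_Un Int_Diff_disjoint finite_Diff finite_Int)
  ultimately show ?thesis by simp
qed

text \<open>One vertex of \<open>K\<close> for each value of \<open>cliques_at\<close>, together
  with \<open>priv c0\<close>, attains the bound; all of them lie in \<open>M c0\<close>.\<close>

lemma ex_twin_free_clique:
  obtains W where "W \<subseteq> pverts \<Gamma>" "\<And>u v. u \<in> W \<Longrightarrow> v \<in> W \<Longrightarrow> v \<in> nbh u"
    "inj_on cliques_at W" "card W = card (cliques_at ` K) + 1"
proof -
  obtain K' where K': "K' \<subseteq> K" "inj_on cliques_at K'" "cliques_at ` K' = cliques_at ` K"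
    using subset_image_inj by (metis order_refl)
  let ?W = "insert (priv c0) K'"
  have sub: "?W \<subseteq> M c0"
    using K'(1) K_subset priv(1) c0 by auto
  \<comment> \<open>\<open>priv c0\<close> lies in the clique \<open>c0\<close> alone, while
    \<open>K_not_private\<close> puts every vertex of \<open>K\<close> in a further clique.\<close>
  have "cliques_at (priv c0) \<notin> cliques_at ` K'"
  proof
    assume "cliques_at (priv c0) \<in> cliques_at ` K'"
    then obtain x where "x \<in> K" "cliques_at x = {c0}"
      using K'(1) cliques_at_priv[OF c0] by auto
    then show False
      using K_not_private[of x] unfolding cliques_at_def by blast
  qed
  then have new: "priv c0 \<notin> K'" and inj: "inj_on cliques_at ?W"
    using K'(2) by (blast, simp add: inj_on_insert, blast)
  have "finite K'"
    using sub finite_M[OF c0] by (auto dest: finite_subset)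
  then have "card ?W = card (cliques_at ` K) + 1"
    using new card_image[OF K'(2)] K'(3) by simp
  moreover have "?W \<subseteq> pverts \<Gamma>"
    using sub M_subset c0 by blast
  moreover have "\<And>u v. u \<in> ?W \<Longrightarrow> v \<in> ?W \<Longrightarrow> v \<in> nbh u"
    using sub c0 unfolding in_nbh_iff by blast
  ultimately show thesis
    using that inj by blast
qed

text \<open>Taking complements turns least strong resolving sets into largest twin-free
  cliques.\<close>

lemma strong_metric_dimension_eq:
  "strong_metric_dimension (with_proj \<Gamma>) = card (pverts \<Gamma>) - card (cliques_at ` K) - 1"
  unfolding strong_metric_dimension_def
proof (rule Min_eqI)
  have "{U. strong_resolving_set (with_proj \<Gamma>) U} \<subseteq> Pow (pverts \<Gamma>)"
    by (auto simp: strong_resolving_set_def)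
  then show "finite (card ` {U. strong_resolving_set (with_proj \<Gamma>) U})"
    using finite_verts finite_subset by blast
next
  fix m assume "m \<in> card ` {U. strong_resolving_set (with_proj \<Gamma>) U}"
  then obtain U where U: "strong_resolving_set (with_proj \<Gamma>) U" "m = card U" by auto
  then have "card (pverts \<Gamma> - U) \<le> card (cliques_at ` K) + 1"
    by (intro card_twin_free_clique_le) (auto simp: strong_resolving_set_iff)
  moreover have "card (pverts \<Gamma> - U) = card (pverts \<Gamma>) - card U"
    using U finite_verts by (meson card_Diff_subset finite_subset strong_resolving_set_iff)
  ultimately show "card (pverts \<Gamma>) - card (cliques_at ` K) - 1 \<le> m"
    using U by simp
next
  obtain W where W: "W \<subseteq> pverts \<Gamma>" "\<And>u v. u \<in> W \<Longrightarrow> v \<in> W \<Longrightarrow> v \<in> nbh u"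
    "inj_on cliques_at W" "card W = card (cliques_at ` K) + 1"
    using ex_twin_free_clique by blast
  have "strong_resolving_set (with_proj \<Gamma>) (pverts \<Gamma> - W)"
    using W by (simp add: strong_resolving_set_iff double_diff)
  moreover have "card (pverts \<Gamma> - W) = card (pverts \<Gamma>) - card (cliques_at ` K) - 1"
    using W finite_verts by (simp add: card_Diff_subset finite_subset)
  ultimately show "card (pverts \<Gamma>) - card (cliques_at ` K) - 1
      \<in> card ` {U. strong_resolving_set (with_proj \<Gamma>) U}"
    by (metis image_eqI mem_Collect_eq)
qed

end

section \<open>Coordinates in the presented group\<close>

text \<open>Conjugation by \<open>a\<close> inverts \<open>b\<close>, so this is the factor that the
  exponent of \<open>b\<close> acquires when \<open>a ^ i\<close> moves past it.\<close>

definition par_sgn :: "int \<Rightarrow> int" where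
  "par_sgn i = (if even i then 1 else - 1)"

text \<open>
  Right multiplication of \<open>a\<^sup>i b\<^sup>j\<close> by a letter. It respects the relations modulo \<open>(2n, 3)\<close>, so
  the coordinates of an element of the presented group are well defined.
\<close>

fun act :: "int \<times> int \<Rightarrow> U6n_gen \<times> bool \<Rightarrow> int \<times> int" where
  "act (i, j) (Gen_a, s) = (i + (if s then 1 else - 1), - j)"
| "act (i, j) (Gen_b, s) = (i, j + (if s then 1 else - 1))"

definition coord_cong :: "nat \<Rightarrow> int \<times> int \<Rightarrow> int \<times> int \<Rightarrow> bool" where
  "coord_cong n x y \<longleftrightarrow> [fst x = fst y] (mod 2 * int n) \<and> [snd x = snd y] (mod 3)"

lemma coord_cong_act: "coord_cong n x y \<Longrightarrow> coord_cong n (act x g) (act y g)"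
  by (cases "(x, g)" rule: act.cases; cases y)
     (auto simp: coord_cong_def cong_iff_dvd_diff algebra_simps
           dest: dvd_diff_commute[THEN iffD1])

lemma coord_cong_foldl: "coord_cong n x y \<Longrightarrow> coord_cong n (foldl act x u) (foldl act y u)"
  by (induction u arbitrary: x y) (auto simp: coord_cong_act)

lemma foldl_act_replicate_a:
  "foldl act (i, j) (replicate m (Gen_a, True)) = (i + int m, par_sgn (int m) * j)"
  by (induction m arbitrary: i j) (auto simp: par_sgn_def)

lemma foldl_act_replicate_b: "foldl act (i, j) (replicate m (Gen_b, True)) = (i, j + int m)"
  by (induction m arbitrary: i j) auto

abbreviation U6n_rels :: "nat \<Rightarrow> (U6n_gen gword \<times> U6n_gen gword) set" where
  "U6n_rels n \<equiv> {(replicate (2 * n) (Gen_a, True), []),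
      (replicate 3 (Gen_b, True), []),
      ([(Gen_b, True), (Gen_a, True)], [(Gen_a, True), (Gen_b, False)])}"

lemma coord_cong_refl: "coord_cong n x x"
  by (simp add: coord_cong_def)

lemma coord_cong_sym: "coord_cong n x y \<Longrightarrow> coord_cong n y x"
  by (simp add: coord_cong_def cong_sym_eq)

lemma coord_cong_trans: "coord_cong n x y \<Longrightarrow> coord_cong n y z \<Longrightarrow> coord_cong n x z"
  unfolding coord_cong_def by (blast intro: cong_trans)

text \<open>This invariant keeps the presented group from collapsing: words with different
  coordinates represent different elements. The start \<open>x\<close> is arbitrary because a
  relation may be applied after any prefix.\<close>

lemma word_eq_coord_cong:
  "word_eq (U6n_rels n) u v \<Longrightarrow> coord_cong n (foldl act x u) (foldl act x v)"
proof (induction arbitrary: x rule: word_eq.induct)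
  case (sym u v)
  then show ?case using coord_cong_sym by blast
next
  case (trans u v w)
  then show ?case using coord_cong_trans by blast
next
  case (cancel u g s v)
  have "act (act y (g, s)) (g, \<not> s) = y" for y
    by (cases y; cases g; cases s) auto
  then show ?case by (simp add: coord_cong_refl)
next
  case (relation l r u v)
  have "coord_cong n (foldl act y l) (foldl act y r)" for y
    using relation by (cases y)
      (auto simp: foldl_act_replicate_a foldl_act_replicate_b coord_cong_def par_sgn_def cong_iff_dvd_diff
            simp del: replicate_Suc)
  then show ?case by (simp add: coord_cong_foldl)
qed (simp add: coord_cong_refl)

section \<open>Calculation with \<open>a ^ i b ^ j\<close> from the relations alone\<close>

locale U6n_group = group G for G (structure) +
  fixes n :: nat and a b
  assumes n_pos: "n \<ge> 1"
    and a_closed: "a \<in> carrier G" and b_closed: "b \<in> carrier G"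
    and a_pow: "a [^] (2 * n) = \<one>" and b_pow: "b [^] (3 :: nat) = \<one>"
    and rel: "b \<otimes> a = a \<otimes> inv b"
begin

definition elt :: "int \<Rightarrow> int \<Rightarrow> 'a" where
  "elt i j = a [^] i \<otimes> b [^] j"

lemma elt_closed [simp]: "elt i j \<in> carrier G"
  by (simp add: elt_def a_closed b_closed)

lemma int_pow_mod:
  assumes "x \<in> carrier G" "x [^] (m::nat) = \<one>" "[i = j] (mod int m)"
  shows "x [^] i = x [^] j"
proof -
  obtain q where "i = j + int m * q"
    using assms(3) by (metis cong_iff_lin cong_sym_eq)
  then show ?thesis
    using assms(1,2) by (simp add: int_pow_mult int_pow_pow[symmetric] int_pow_int)
qed

lemma elt_cong: "[i = i'] (mod 2 * int n) \<Longrightarrow> [j = j'] (mod 3) \<Longrightarrow> elt i j = elt i' j'"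
  using int_pow_mod[OF a_closed a_pow, of i i'] int_pow_mod[OF b_closed b_pow, of j j']
  by (simp add: elt_def)

lemma b_pow_a: "b [^] (j::int) \<otimes> a = a \<otimes> b [^] (- j)"
proof -
  have nat: "b [^] (m::nat) \<otimes> a = a \<otimes> b [^] (- int m)" for m
  proof (induction m)
    case 0
    then show ?case by (simp add: a_closed)
  next
    case (Suc m)
    have "b [^] Suc m \<otimes> a = b [^] m \<otimes> (b \<otimes> a)"
      by (simp add: m_assoc a_closed b_closed)
    also have "\<dots> = b [^] m \<otimes> a \<otimes> inv b"
      by (simp add: rel m_assoc a_closed b_closed)
    also have "\<dots> = a \<otimes> (b [^] (- int m) \<otimes> b [^] (- 1 :: int))"
      by (simp add: Suc m_assoc a_closed b_closed int_pow_neg)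
    also have "\<dots> = a \<otimes> b [^] (- int m + - 1)"
      by (simp only: int_pow_mult[OF b_closed])
    also have "- int m + - 1 = - int (Suc m)"
      by simp
    finally show ?case .
  qed
  \<comment> \<open>As \<open>b\<close> has exponent 3, a natural residue can replace a possibly
    negative exponent.\<close>
  define m where "m = nat (j mod 3)"
  have m: "[j = int m] (mod int 3)"
    by (simp add: m_def cong_def)
  then have m': "[- j = - int m] (mod int 3)"
    by (simp only: cong_minus_minus_iff)
  have "b [^] j \<otimes> a = b [^] int m \<otimes> a"
    using int_pow_mod[OF b_closed b_pow m] by simp
  also have "\<dots> = a \<otimes> b [^] (- int m)"
    using nat[of m] by (simp add: int_pow_int)
  also have "\<dots> = a \<otimes> b [^] (- j)"
    using int_pow_mod[OF b_closed b_pow m'] by simp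
  finally show ?thesis .
qed

lemma b_pow_a_pow: "b [^] (j::int) \<otimes> a [^] (i::int) = a [^] i \<otimes> b [^] (par_sgn i * j)"
proof -
  have nat: "b [^] (j::int) \<otimes> a [^] m = a [^] m \<otimes> b [^] (par_sgn (int m) * j)" for j and m :: nat
  proof (induction m)
    case 0
    then show ?case by (simp add: b_closed par_sgn_def)
  next
    case (Suc m)
    have "b [^] j \<otimes> a [^] Suc m = (b [^] j \<otimes> a [^] m) \<otimes> a"
      by (simp add: m_assoc a_closed b_closed)
    also have "\<dots> = a [^] m \<otimes> (b [^] (par_sgn (int m) * j) \<otimes> a)"
      by (simp add: Suc m_assoc a_closed b_closed)
    also have "\<dots> = a [^] Suc m \<otimes> b [^] (par_sgn (int (Suc m)) * j)"
      by (simp add: b_pow_a m_assoc[symmetric] a_closed b_closed par_sgn_def)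
    finally show ?case .
  qed
  define m where "m = nat (i mod (2 * int n))"
  have m: "[i = int m] (mod int (2 * n))"
    using n_pos by (simp add: m_def cong_def)
  \<comment> \<open>Reduction keeps the parity because the modulus \<open>2 * n\<close> is
    even.\<close>
  have "par_sgn i = par_sgn (int m)"
    using n_pos by (auto simp: par_sgn_def m_def dvd_mod_iff)
  then show ?thesis
    using nat[of j m] int_pow_mod[OF a_closed a_pow m] by (simp add: int_pow_int)
qed

lemma elt_mult: "elt i j \<otimes> elt i' j' = elt (i + i') (par_sgn i' * j + j')"
proof -
  have "elt i j \<otimes> elt i' j' = a [^] i \<otimes> (b [^] j \<otimes> a [^] i') \<otimes> b [^] j'"
    by (simp add: elt_def m_assoc a_closed b_closed)
  also have "\<dots> = (a [^] i \<otimes> a [^] i') \<otimes> (b [^] (par_sgn i' * j) \<otimes> b [^] j')"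
    by (simp add: b_pow_a_pow m_assoc a_closed b_closed)
  finally show ?thesis
    by (simp add: elt_def int_pow_mult a_closed b_closed)
qed

lemma elt_one: "\<one> = elt 0 0"
  by (simp add: elt_def)

lemma elt_inv: "inv (elt i j) = elt (- i) (- par_sgn i * j)"
  by (rule inv_equality) (auto simp: elt_mult elt_one par_sgn_def)

end

text \<open>The first assumption makes \<open>a\<close> and \<open>b\<close> generate the group; the
  second excludes any collapse beyond the given relations.\<close>

locale U6n_group_full = U6n_group +
  assumes carrier_subset: "carrier G \<subseteq> {elt i j |i j. True}"
    and elt_eqD: "elt i j = elt i' j' \<Longrightarrow> [i = i'] (mod 2 * int n) \<and> [j = j'] (mod 3)"

section \<open>Normal forms in the presented group\<close>

definition word_class :: "nat \<Rightarrow> U6n_gen gword \<Rightarrow> U6n_gen gword set" where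
  "word_class n u = word_rel (U6n_rels n) `` {u}"

lemma word_class_eq_iff: "word_class n u = word_class n v \<longleftrightarrow> word_eq (U6n_rels n) u v"
  unfolding word_class_def eq_equiv_class_iff[OF equiv_word_rel UNIV_I UNIV_I]
  by (simp add: word_rel_def)

lemma word_class_mult: "word_class n u \<otimes>\<^bsub>U6n n\<^esub> word_class n v = word_class n (u @ v)"
  by (simp add: word_class_def U6n_def presented_group_mult)

lemma word_class_one: "\<one>\<^bsub>U6n n\<^esub> = word_class n []"
  by (simp add: word_class_def U6n_def presented_group_def)

lemma carrier_U6n: "carrier (U6n n) = range (word_class n)"
  by (auto simp: word_class_def U6n_def presented_group_def quotient_def)

lemma word_class_pow: "word_class n [x] [^]\<^bsub>U6n n\<^esub> (m::nat) = word_class n (replicate m x)"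
  by (induction m)
     (simp_all add: nat_pow_def word_class_one word_class_mult replicate_append_same)

lemma word_class_inv: "inv\<^bsub>U6n n\<^esub> word_class n [(g, True)] = word_class n [(g, False)]"
proof -
  interpret group "U6n n" by (simp add: U6n_def group_presented_group)
  have "word_eq (U6n_rels n) ([] @ [(g, False), (g, \<not> False)] @ []) ([] @ [])"
    by (rule word_eq.cancel)
  then show ?thesis
    by (intro inv_equality)
       (auto simp: word_class_mult word_class_one word_class_eq_iff carrier_U6n)
qed

lemma word_class_relation: "(l, r) \<in> U6n_rels n \<Longrightarrow> word_class n l = word_class n r"
  using word_eq.relation[of l r "U6n_rels n" "[]" "[]"] by (simp add: word_class_eq_iff)

text \<open>Generation follows by induction on words. Distinctness holds since each normal form is
  the class of a word with the same coordinates, and these depend only on the class.\<close>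

lemma U6n_group_full_U6n:
  assumes "n \<ge> 1"
  shows "U6n_group_full (U6n n) n (word_class n [(Gen_a, True)]) (word_class n [(Gen_b, True)])"
proof -
  let ?a = "word_class n [(Gen_a, True)]" and ?b = "word_class n [(Gen_b, True)]"
  interpret group "U6n n" by (simp add: U6n_def group_presented_group)
  interpret U6n_group "U6n n" n ?a ?b
  proof
    show "?a [^]\<^bsub>U6n n\<^esub> (2 * n) = \<one>\<^bsub>U6n n\<^esub>"
      unfolding word_class_pow word_class_one by (rule word_class_relation) simp
    show "?b [^]\<^bsub>U6n n\<^esub> (3 :: nat) = \<one>\<^bsub>U6n n\<^esub>"
      unfolding word_class_pow word_class_one by (rule word_class_relation) simp
    show "?b \<otimes>\<^bsub>U6n n\<^esub> ?a = ?a \<otimes>\<^bsub>U6n n\<^esub> inv\<^bsub>U6n n\<^esub> ?b"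
      unfolding word_class_inv word_class_mult by (rule word_class_relation) simp
  qed (use assms in \<open>auto simp: carrier_U6n\<close>)
  have letter: "\<exists>i j. word_class n [(g, s)] = elt i j" for g s
  proof -
    have "elt 1 0 = ?a" "elt 0 1 = ?b" "elt (- 1) 0 = inv\<^bsub>U6n n\<^esub> ?a" "elt 0 (- 1) = inv\<^bsub>U6n n\<^esub> ?b"
      using a_closed b_closed by (simp_all add: elt_def int_pow_neg)
    then show ?thesis
      by (cases g; cases s) (metis word_class_inv)+
  qed
  have word: "\<exists>i j. word_class n w = elt i j" for w
  proof (induction w)
    case Nil
    then show ?case using elt_one word_class_one by metis
  next
    case (Cons x w)
    then show ?case
      using letter[of "fst x" "snd x"] word_class_mult[of n "[x]" w] elt_mult by (cases x) fastforce
  qed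
  have elt_nat: "elt (int p) (int q) = word_class n (replicate p (Gen_a, True) @ replicate q (Gen_b, True))"
    for p q
    by (simp add: elt_def int_pow_int word_class_pow word_class_mult)
  \<comment> \<open>Exponents are reduced to natural numbers, which gives an explicit word without
    inverse letters whose coordinates can be computed.\<close>
  have elt_word: "\<exists>w. elt i j = word_class n w \<and> coord_cong n (i, j) (foldl act (0, 0) w)" for i j
  proof -
    let ?p = "nat (i mod (2 * int n))" and ?q = "nat (j mod 3)"
    have "elt i j = elt (int ?p) (int ?q)"
      using assms by (intro elt_cong) (auto simp: cong_def)
    then show ?thesis unfolding elt_nat using assms
      by (intro exI conjI) (auto simp: foldl_act_replicate_a foldl_act_replicate_b coord_cong_def cong_def)
  qed
  show ?thesis
  proof
    show "carrier (U6n n) \<subseteq> {elt i j |i j. True}"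
      using word by (auto simp: carrier_U6n)
    fix i j i' j' assume *: "elt i j = elt i' j'"
    obtain w w' where w: "elt i j = word_class n w" "coord_cong n (i, j) (foldl act (0, 0) w)"
        "elt i' j' = word_class n w'" "coord_cong n (i', j') (foldl act (0, 0) w')"
      using elt_word by meson
    with * have "coord_cong n (foldl act (0, 0) w) (foldl act (0, 0) w')"
      by (metis word_class_eq_iff word_eq_coord_cong)
    then have "coord_cong n (i, j) (i', j')"
      using w(2,4) by (blast intro: coord_cong_trans coord_cong_sym)
    then show "[i = i'] (mod 2 * int n) \<and> [j = j'] (mod 3)"
      by (simp add: coord_cong_def)
  qed
qed

section \<open>Maximal cyclic subgroups\<close>

text \<open>
  \<open>mc_coords k c i j\<close> says that \<open>a\<^sup>i b\<^sup>j\<close> lies in the maximal cyclic subgroup \<open>c\<close>. \<open>Axis h\<close> is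
  generated by \<open>a b\<^sup>h\<close>. The others lie in \<open>\<langle>a\<^sup>2\<rangle> \<times> \<langle>b\<rangle>\<close> and contain its \<open>3'\<close>-part. With the
  \<open>3\<close>-part of \<open>a\<^sup>i b\<^sup>j\<close> written as \<open>(i, j)\<close> in \<open>\<int>/3\<^sup>k \<times> \<int>/3\<close>, the \<open>3\<close>-part of \<open>Flat\<close> is generated by \<open>(0, 1)\<close> and
  that of \<open>Skew s d\<close> by \<open>(d 3\<^sup>s, 1)\<close>, where \<open>s < k\<close> and \<open>d = \<plusminus>1\<close>.
\<close>

datatype max_cyclic = Axis int | Skew nat int | Flat

fun mc_coords :: "nat \<Rightarrow> max_cyclic \<Rightarrow> int \<Rightarrow> int \<Rightarrow> bool" where
  "mc_coords k (Axis h) i j \<longleftrightarrow> (if even i then 3 dvd j else 3 dvd j - h)"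
| "mc_coords k (Skew s d) i j \<longleftrightarrow> even i \<and> 3 ^ Suc s dvd i - d * j * 3 ^ s"
| "mc_coords k Flat i j \<longleftrightarrow> even i \<and> 3 ^ k dvd i"

definition mc_index :: "nat \<Rightarrow> max_cyclic set" where
  "mc_index k = Axis ` {0, 1, 2} \<union> case_prod Skew ` ({..<k} \<times> {1, - 1}) \<union> {Flat}"

lemma mc_index_cases:
  assumes "c \<in> mc_index k"
  obtains (Axis) h where "c = Axis h" "h \<in> {0, 1, 2}"
  | (Skew) s d where "c = Skew s d" "s < k" "d = 1 \<or> d = - 1"
  | (Flat) "c = Flat"
  using assms unfolding mc_index_def by auto

lemma mc_index_simps [simp]:
  "Axis h \<in> mc_index k \<longleftrightarrow> h \<in> {0, 1, 2}"
  "Skew s d \<in> mc_index k \<longleftrightarrow> s < k \<and> (d = 1 \<or> d = - 1)"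
  "Flat \<in> mc_index k"
  by (auto simp: mc_index_def)

lemma finite_mc_index: "finite (mc_index k)"
  by (simp add: mc_index_def)

lemma card_mc_index: "card (mc_index k) = 2 * k + 4"
proof -
  let ?A = "Axis ` {0, 1, 2}" and ?S = "case_prod Skew ` ({..<k} \<times> {1, - 1})"
  have "card ?A = 3"
    by (subst card_image) (auto simp: inj_on_def)
  moreover have "card ?S = 2 * k"
    by (subst card_image) (auto simp: inj_on_def card_cartesian_product)
  moreover have "card (?A \<union> ?S) = card ?A + card ?S"
    by (rule card_Un_disjoint) auto
  moreover have "card (?A \<union> ?S \<union> {Flat}) = card (?A \<union> ?S) + card {Flat}"
    by (rule card_Un_disjoint) auto
  ultimately show ?thesis by (simp add: mc_index_def)
qed

text \<open>This is closure under the group product in coordinates. Two odd members of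
  \<open>Axis h\<close> give \<open>- h + h = 0\<close> modulo 3; in \<open>Skew\<close> and
  \<open>Flat\<close> the even exponents leave no sign, so the conditions are linear.\<close>

lemma mc_coords_add:
  assumes "mc_coords k c i j" "mc_coords k c i' j'"
  shows "mc_coords k c (i + i') (par_sgn i' * j + j')"
proof (cases c)
  case (Axis h)
  then show ?thesis
    using assms by (auto simp: par_sgn_def split: if_splits; presburger)
next
  case (Skew s d)
  then have "3 ^ Suc s dvd (i - d * j * 3 ^ s) + (i' - d * j' * 3 ^ s)"
    using assms by (intro dvd_add) auto
  then show ?thesis
    using assms Skew by (simp add: par_sgn_def algebra_simps)
next
  case Flat
  then show ?thesis using assms by simp
qed

lemma mc_coords_minus:
  assumes "mc_coords k c i j"
  shows "mc_coords k c (- i) (- par_sgn i * j)"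
proof (cases c)
  case (Skew s d)
  have "- i - d * (- j) * 3 ^ s = - (i - d * j * 3 ^ s)"
    by simp
  then show ?thesis
    using assms Skew by (metis dvd_minus_iff even_minus mc_coords.simps(2) mult_minus1 par_sgn_def)
qed (use assms in \<open>auto simp: par_sgn_def\<close>)

text \<open>Coordinates are determined only modulo \<open>2 * n\<close> and 3. As
  \<open>2 * 3 ^ k\<close> divides \<open>2 * n\<close>, this makes membership independent of the
  chosen coordinates.\<close>

lemma mc_coords_shift:
  assumes "mc_coords k c i j" "c \<in> mc_index k" "2 * 3 ^ k dvd i' - i" "3 dvd j' - j"
  shows "mc_coords k c i' j'"
proof -
  have k: "3 ^ k dvd i' - i" and "even (i' - i)"
    using assms(3) dvd_mult_left dvd_mult_right by blast+
  then have par: "even i' \<longleftrightarrow> even i"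
    by simp
  show ?thesis using assms(2)
  proof (cases rule: mc_index_cases)
    case (Axis h)
    have "j' = (j' - j) + j" "j' - h = (j' - j) + (j - h)" by auto
    then show ?thesis
      using assms(1,4) par Axis by (metis dvd_add mc_coords.simps(1))
  next
    case (Skew s d)
    have "(3::int) ^ Suc s dvd 3 ^ k"
      using Skew(2) by (intro le_imp_power_dvd) simp
    then have "3 ^ Suc s dvd i' - i"
      using k dvd_trans by blast
    moreover have "3 ^ Suc s dvd d * (j' - j) * 3 ^ s"
      using assms(4) by (auto simp: dvd_def algebra_simps)
    moreover have "i' - d * j' * 3 ^ s = (i' - i) + (i - d * j * 3 ^ s) - d * (j' - j) * 3 ^ s"
      by (simp add: algebra_simps)
    ultimately have "3 ^ Suc s dvd i' - d * j' * 3 ^ s"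
      using assms(1) Skew(1) by (metis dvd_add dvd_diff mc_coords.simps(2))
    then show ?thesis
      using assms(1) par Skew(1) by simp
  next
    case Flat
    have "i' = (i' - i) + i" by simp
    then show ?thesis
      using assms(1) par k Flat by (metis dvd_add mc_coords.simps(3))
  qed
qed

text \<open>\<open>v\<close> is the 3-adic valuation of \<open>i\<close> capped at \<open>k\<close>,
  so that \<open>i = 0\<close> gets the value \<open>k\<close>.\<close>

lemma pow3_level:
  fixes i :: int
  obtains v where "v \<le> k" "\<And>u. u \<le> k \<Longrightarrow> 3 ^ u dvd i \<longleftrightarrow> u \<le> v"
proof -
  let ?S = "{u. u \<le> k \<and> 3 ^ u dvd i}"
  have fin: "finite ?S" and "0 \<in> ?S" by auto
  then have "Max ?S \<in> ?S" by (intro Max_in) auto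
  then have max: "Max ?S \<le> k" "3 ^ Max ?S dvd i" by auto
  have "3 ^ u dvd i \<longleftrightarrow> u \<le> Max ?S" if "u \<le> k" for u
  proof
    assume "u \<le> Max ?S"
    then show "3 ^ u dvd i"
      using max(2) by (metis dvd_trans le_imp_power_dvd)
  qed (use that fin in \<open>intro Max_ge; simp\<close>)
  then show thesis using that max(1) by blast
qed

lemma ex_mc_coords: "\<exists>c\<in>mc_index k. mc_coords k c i j"
proof -
  consider "odd i" | "even i" "3 ^ k dvd i" | "even i" "3 dvd j" | "even i" "\<not> 3 ^ k dvd i" "\<not> 3 dvd j"
    by blast
  then show ?thesis
  proof cases
    case 1
    have "3 dvd j - j mod 3" "j mod 3 \<in> {0, 1, 2}"
      by (auto simp: mod_eq_dvd_iff[symmetric])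
    then show ?thesis
      using 1 by (intro bexI[of _ "Axis (j mod 3)"]) auto
  next
    case 2
    then show ?thesis by (intro bexI[of _ Flat]) auto
  next
    case 3
    then show ?thesis by (intro bexI[of _ "Axis 0"]) auto
  next
    case 4
    obtain v where v: "v \<le> k" "\<And>u. u \<le> k \<Longrightarrow> 3 ^ u dvd i \<longleftrightarrow> u \<le> v"
      using pow3_level by blast
    then have "v < k"
      using 4(2) by (metis order.order_iff_strict order_refl)
    then have "3 ^ v dvd i" "\<not> 3 ^ Suc v dvd i"
      using v(2)[of v] v(2)[of "Suc v"] by (simp_all del: power_Suc)
    then obtain r where r: "i = 3 ^ v * r" "\<not> 3 dvd r"
      by (auto simp: dvd_def)
    \<comment> \<open>Both \<open>r\<close> and \<open>j\<close> are 1 or -1 modulo 3, so they agree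
      up to a sign, which becomes \<open>d\<close>.\<close>
    then have "3 dvd r - j \<or> 3 dvd r + j"
      using 4(3) by presburger
    then obtain d where d: "d = 1 \<or> d = - 1" "3 dvd r - d * j"
      by (metis diff_minus_eq_add mult_1 mult_minus1)
    then have "3 ^ v * 3 dvd 3 ^ v * (r - d * j)"
      by (intro mult_dvd_mono) auto
    then have "mc_coords k (Skew v d) i j"
      using r 4(1) by (simp add: algebra_simps)
    then show ?thesis
      using d(1) \<open>v < k\<close> by (metis mc_index_simps(2))
  qed
qed

text \<open>Here \<open>i = 3 ^ s * (d * j + 3 * q)\<close> with a cofactor prime to 3. Hence
  \<open>i\<close> determines \<open>s\<close> as its valuation, and the cofactor modulo 3
  determines \<open>d\<close>.\<close>

lemma Skew_coords_level:
  assumes "mc_coords k (Skew s d) i j" "\<not> 3 dvd j" "d = 1 \<or> d = - 1"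
  shows "3 ^ s dvd i" "\<not> 3 ^ Suc s dvd i" "3 dvd i div 3 ^ s - d * j"
proof -
  obtain q where "i - d * j * 3 ^ s = 3 ^ Suc s * q"
    using assms(1) by auto
  then have i: "i = 3 ^ s * (d * j + 3 * q)"
    by (simp add: algebra_simps)
  then show "3 ^ s dvd i" "3 dvd i div 3 ^ s - d * j"
    by simp_all
  have "\<not> 3 dvd d * j + 3 * q"
    using assms(2,3) by (elim disjE) (simp_all, presburger+)
  then show "\<not> 3 ^ Suc s dvd i"
    using i by simp
qed

text \<open>For odd \<open>i\<close> only \<open>Axis\<close> occurs and \<open>h\<close> is
  \<open>j\<close> modulo 3. For even \<open>i\<close> no \<open>Axis\<close> contains the element,
  and the valuation of \<open>i\<close> separates \<open>Flat\<close> and the different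
  \<open>s\<close>.\<close>

lemma mc_coords_unique:
  assumes "c \<in> mc_index k" "c' \<in> mc_index k" "mc_coords k c i j" "mc_coords k c' i j"
    "odd i \<or> \<not> 3 dvd j"
  shows "c = c'"
proof (cases "even i")
  case False
  then obtain h h' where h: "c = Axis h" "c' = Axis h'" "h \<in> {0, 1, 2}" "h' \<in> {0, 1, 2}"
      "3 dvd j - h" "3 dvd j - h'"
    using assms by (auto elim!: mc_index_cases)
  then have "3 dvd h' - h"
    using dvd_diff[of 3 "j - h" "j - h'"] by simp
  then show ?thesis using h by auto
next
  case True
  then have j: "\<not> 3 dvd j" using assms(5) by simp
  have lev: "c = Flat \<and> 3 ^ k dvd i \<or> (\<exists>s d. c = Skew s d \<and> s < k \<and> d \<in> {1, - 1} \<and>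
      3 ^ s dvd i \<and> \<not> 3 ^ Suc s dvd i \<and> 3 dvd i div 3 ^ s - d * j)"
    if "c \<in> mc_index k" "mc_coords k c i j" for c
    using that(1)
  proof (cases rule: mc_index_cases)
    case (Skew s d)
    then show ?thesis using Skew_coords_level[of k s d i j] that(2) j by blast
  qed (use that True j in auto)
  have le: "(3::int) ^ Suc s dvd 3 ^ u" if "s < u" for s u
    using that by (intro le_imp_power_dvd) simp
  from lev[OF assms(1,3)] lev[OF assms(2,4)] show ?thesis
  proof (elim disjE exE conjE)
    fix s d s' d'
    assume *: "c = Skew s d" "c' = Skew s' d'" "d \<in> {1, - 1}" "d' \<in> {1, - 1}"
      "3 ^ s dvd i" "\<not> 3 ^ Suc s dvd i" "3 ^ s' dvd i" "\<not> 3 ^ Suc s' dvd i"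
      "3 dvd i div 3 ^ s - d * j" "3 dvd i div 3 ^ s' - d' * j"
    have "s = s'"
      using * le[of s s'] le[of s' s] dvd_trans by (metis linorder_neqE_nat)
    then have "3 dvd d' * j - d * j"
      using *(9,10) dvd_diff[of 3 "i div 3 ^ s - d * j" "i div 3 ^ s - d' * j"] by simp
    then have "d = d'"
      using *(3,4) j by (auto; presburger)
    then show ?thesis using * \<open>s = s'\<close> by simp
  qed (use le in \<open>blast intro: dvd_trans\<close>)+
qed

section \<open>The maximal cyclic subgroups as a clique cover\<close>

locale U6n_group_factored = U6n_group_full +
  fixes k t :: nat
  assumes n_eq: "n = 3 ^ k * t" and t_pos: "t > 0" and not_3_dvd_t: "\<not> 3 dvd t"
begin

abbreviation \<Gamma> where "\<Gamma> \<equiv> enhanced_power_graph G"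

definition M :: "max_cyclic \<Rightarrow> 'a set" where
  "M c = {elt i j |i j. mc_coords k c i j}"

text \<open>This is the centre, generated by \<open>a ^ 2\<close>; the condition on \<open>j\<close>
  makes the factor \<open>b ^ j\<close> trivial.\<close>

definition K :: "'a set" where
  "K = {elt i j |i j. even i \<and> 3 dvd j}"

lemma elt_eq_iff: "elt i j = elt i' j' \<longleftrightarrow> 2 * int n dvd i - i' \<and> 3 dvd j - j'"
  using elt_eqD elt_cong unfolding cong_iff_dvd_diff by blast

lemma carrier_eq: "carrier G = {elt i j |i j. True}"
  using carrier_subset by auto

lemma elt_in_M: "c \<in> mc_index k \<Longrightarrow> elt i j \<in> M c \<longleftrightarrow> mc_coords k c i j"
proof
  assume c: "c \<in> mc_index k" and "elt i j \<in> M c"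
  then obtain i' j' where *: "mc_coords k c i' j'" "2 * int n dvd i - i'" "3 dvd j - j'"
    by (auto simp: M_def elt_eq_iff)
  have "2 * 3 ^ k dvd 2 * int n"
    by (simp add: n_eq)
  then have "2 * 3 ^ k dvd i - i'"
    using *(2) dvd_trans by blast
  then show "mc_coords k c i j"
    using mc_coords_shift[OF *(1) c] *(3) by blast
qed (auto simp: M_def)

lemma elt_in_K: "elt i j \<in> K \<longleftrightarrow> even i \<and> 3 dvd j"
proof
  assume "elt i j \<in> K"
  then obtain i' j' where *: "even i'" "3 dvd j'" "2 * int n dvd i - i'" "3 dvd j - j'"
    by (auto simp: K_def elt_eq_iff)
  then have "even (i - i')"
    using dvd_mult_left by blast
  then show "even i \<and> 3 dvd j"
    using *(1,2) dvd_add[OF *(4,2)] by simp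
qed (auto simp: K_def)

lemma subgroup_M: "subgroup (M c) G"
proof (rule subgroupI)
  have "mc_coords k c 0 0"
    by (cases c) auto
  then show "M c \<noteq> {}"
    unfolding M_def by blast
  fix x assume "x \<in> M c"
  then obtain i j where x: "x = elt i j" "mc_coords k c i j" by (auto simp: M_def)
  then show "inv x \<in> M c"
    using mc_coords_minus[OF x(2)] unfolding M_def x(1) elt_inv by blast
  fix y assume "y \<in> M c"
  then obtain i' j' where y: "y = elt i' j'" "mc_coords k c i' j'" by (auto simp: M_def)
  show "x \<otimes> y \<in> M c"
    using mc_coords_add[OF x(2) y(2)] unfolding M_def x(1) y(1) elt_mult by blast
qed (auto simp: M_def)

lemma even_elt_pow: "even i \<Longrightarrow> elt i j [^] (p::int) = elt (i * p) (j * p)"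
proof -
  assume "even i"
  moreover have "elt i j [^] (m::nat) = elt (i * int m) (j * int m)" for m
    by (induction m) (use \<open>even i\<close> in \<open>auto simp: elt_one elt_mult par_sgn_def algebra_simps\<close>)
  ultimately show ?thesis
    by (cases p rule: int_cases2) (auto simp: int_pow_int int_pow_neg elt_inv par_sgn_def)
qed

text \<open>The square of \<open>a b ^ h\<close> is \<open>a ^ 2\<close>, since \<open>b ^ h\<close>
  is inverted on passing \<open>a\<close>.\<close>

lemma odd_elt_pow: "elt 1 h [^] (p::int) = elt p (if even p then 0 else h)"
proof -
  have "elt 1 h [^] (m::nat) = elt (int m) (if even m then 0 else h)" for m
    by (induction m) (auto simp: elt_one elt_mult par_sgn_def add.commute)
  then show ?thesis
    by (cases p rule: int_cases2) (auto simp: int_pow_int int_pow_neg elt_inv par_sgn_def)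
qed

lemma coprime_pow3_t: "coprime (3 ^ k) (int t)"
proof -
  have "coprime 3 t"
    using not_3_dvd_t by (simp add: prime_imp_coprime)
  then have "coprime (int 3) (int t)"
    by (simp only: coprime_int_iff)
  then show ?thesis by simp
qed

lemma ex_crt: "\<exists>x. 3 ^ k dvd x - u \<and> int t dvd x - (v::int)"
  using binary_chinese_remainder_int[OF coprime_pow3_t, of u v] by (simp add: cong_iff_dvd_diff)

lemma n_dvdI: "3 ^ k dvd x \<Longrightarrow> int t dvd x \<Longrightarrow> int n dvd x"
  using divides_mult[OF _ _ coprime_pow3_t] by (simp add: n_eq)

lemma M_cyclic:
  assumes "c \<in> mc_index k"
  shows "\<exists>g\<in>M c. \<forall>x\<in>M c. \<exists>p::int. x = g [^] p"
  using assms
proof (cases rule: mc_index_cases)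
  case (Axis h)
  have "elt 1 h \<in> M c"
    using elt_in_M[OF assms, of 1 h] Axis by simp
  moreover have "elt i j = elt 1 h [^] i" if "mc_coords k c i j" for i j
    using that unfolding odd_elt_pow elt_eq_iff by (auto simp: Axis)
  ultimately show ?thesis unfolding M_def by blast
next
  case (Skew s d)
  \<comment> \<open>Since -2 is 1 modulo 3, \<open>2 * l\<close> is congruent to
    \<open>d * 3 ^ s\<close> modulo \<open>3 ^ Suc s\<close>, as membership with
    \<open>j = 1\<close> requires. Modulo \<open>t\<close> the exponent is that of
    \<open>a ^ 2\<close>.\<close>
  obtain l where l: "3 ^ k dvd l - (- d * 3 ^ s)" "int t dvd l - 1"
    using ex_crt by blast
  have le: "3 ^ Suc s dvd (3::int) ^ k"
    using Skew(2) by (intro le_imp_power_dvd) simp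
  have dd: "d * d = 1" using Skew by auto
  have "3 ^ Suc s dvd l + d * 3 ^ s"
    using dvd_trans[OF le l(1)] by simp
  then have "3 ^ Suc s dvd 2 * (l + d * 3 ^ s) - 3 ^ Suc s * d"
    by (rule dvd_diff[OF dvd_mult dvd_triv_left])
  moreover have "2 * (l + d * 3 ^ s) - 3 ^ Suc s * d = 2 * l - d * 3 ^ s"
    by (simp add: algebra_simps)
  ultimately have "elt (2 * l) 1 \<in> M c"
    using elt_in_M[OF assms, of "2 * l" 1] Skew by simp
  moreover have "\<exists>p. elt i j = elt (2 * l) 1 [^] (p::int)" if ij: "mc_coords k c i j" for i j
  proof -
    obtain m where m: "i = 2 * m" using ij Skew by auto
    obtain q where q: "i - d * j * 3 ^ s = 3 ^ Suc s * q"
      using ij Skew by auto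
    have "3 ^ Suc s dvd 2 * (m + d * j * 3 ^ s)"
    proof
      show "2 * (m + d * j * 3 ^ s) = 3 ^ Suc s * (q + d * j)"
        using q m by (simp add: algebra_simps)
    qed
    then have "3 ^ Suc s dvd m + d * j * 3 ^ s"
      by (subst (asm) coprime_dvd_mult_right_iff) auto
    then obtain w where w: "m + d * j * 3 ^ s = 3 ^ Suc s * w" ..
    \<comment> \<open>The exponent has to satisfy \<open>l * p = m\<close> modulo \<open>n\<close>
      and \<open>p = j\<close> modulo 3. Modulo \<open>3 ^ k\<close> the first reads
      \<open>- d * 3 ^ s * p = m\<close>, which \<open>j - 3 * d * w\<close> solves because
      \<open>d * d = 1\<close>.\<close>
    obtain p where p: "3 ^ k dvd p - (j - 3 * d * w)" "int t dvd p - m"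
      using ex_crt by blast
    have "3 ^ k dvd (l - (- d * 3 ^ s)) * p - d * 3 ^ s * (p - (j - 3 * d * w))"
      by (rule dvd_diff[OF dvd_mult2[OF l(1)] dvd_mult[OF p(1)]])
    moreover have "(l - (- d * 3 ^ s)) * p - d * 3 ^ s * (p - (j - 3 * d * w))
        = l * p + d * j * 3 ^ s - (d * d) * 3 ^ Suc s * w"
      by (simp add: algebra_simps)
    ultimately have "3 ^ k dvd l * p + d * j * 3 ^ s - 3 ^ Suc s * w"
      by (simp only: dd mult_1_left)
    then have "3 ^ k dvd l * p - m"
      unfolding w[symmetric] by simp
    moreover have "int t dvd (l - 1) * p + (p - m)"
      using l(2) p(2) by (intro dvd_add dvd_mult2)
    then have "int t dvd l * p - m"
      by (simp add: algebra_simps)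
    ultimately have "2 * int n dvd 2 * (m - l * p)"
      using n_dvdI by (metis dvd_minus_iff minus_diff_eq mult_dvd_mono dvd_refl)
    moreover have "3 dvd j - p"
    proof -
      have "3 dvd (3::int) ^ k"
        using le by (simp add: dvd_mult_left)
      then have "3 dvd p - (j - 3 * d * w)"
        using p(1) dvd_trans by blast
      moreover have "j - p = 3 * (d * w) - (p - (j - 3 * d * w))"
        by simp
      ultimately show ?thesis by (metis dvd_diff dvd_triv_left)
    qed
    ultimately have "elt i j = elt (2 * l) 1 [^] p"
      by (simp add: even_elt_pow elt_eq_iff m algebra_simps)
    then show ?thesis ..
  qed
  ultimately show ?thesis unfolding M_def by blast
next
  case Flat
  \<comment> \<open>The 3-part of this generator is just \<open>b\<close>, and its remaining part is
    that of \<open>a ^ 2\<close>.\<close>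
  obtain l where l: "3 ^ k dvd l - 0" "int t dvd l - 1"
    using ex_crt by blast
  then have "elt (2 * l) 1 \<in> M c"
    using elt_in_M[OF assms, of "2 * l" 1] Flat by simp
  moreover have "\<exists>p. elt i j = elt (2 * l) 1 [^] (p::int)" if ij: "mc_coords k c i j" for i j
  proof -
    obtain m where m: "i = 2 * m" using ij Flat by auto
    then have "3 ^ k dvd m"
      using ij Flat by (simp add: coprime_dvd_mult_right_iff)
    have "coprime (3 :: int) (int t)"
      using not_3_dvd_t prime_imp_coprime[of 3 t] coprime_int_iff[of 3 t] by simp
    \<comment> \<open>Modulo \<open>3 ^ k\<close> both \<open>l\<close> and \<open>m\<close> vanish,
      so \<open>p\<close> is free to match \<open>j\<close> modulo 3.\<close>
    then obtain p where p: "3 dvd p - j" "int t dvd p - m"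
      using binary_chinese_remainder_int[of 3 "int t" j m] by (auto simp: cong_iff_dvd_diff)
    have "3 ^ k dvd l * p - m"
      using l(1) \<open>3 ^ k dvd m\<close> by (intro dvd_diff dvd_mult2) auto
    moreover have "int t dvd (l - 1) * p + (p - m)"
      using l(2) p(2) by (intro dvd_add dvd_mult2)
    then have "int t dvd l * p - m"
      by (simp add: algebra_simps)
    ultimately have "2 * int n dvd 2 * (m - l * p)"
      using n_dvdI by (metis dvd_minus_iff minus_diff_eq mult_dvd_mono dvd_refl)
    moreover have "3 dvd j - p"
      using p(1) by (metis dvd_minus_iff minus_diff_eq)
    ultimately have "elt i j = elt (2 * l) 1 [^] p"
      by (simp add: even_elt_pow elt_eq_iff m algebra_simps)
    then show ?thesis ..
  qed
  ultimately show ?thesis unfolding M_def by blast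
qed

lemma cyclic_group_M:
  assumes "c \<in> mc_index k"
  shows "cyclic_group (G\<lparr>carrier := M c\<rparr>)"
proof -
  interpret H: group "G\<lparr>carrier := M c\<rparr>"
    by (rule subgroup_imp_group[OF subgroup_M])
  obtain g where g: "g \<in> M c" "\<forall>x\<in>M c. \<exists>p::int. x = g [^] p"
    using M_cyclic[OF assms] by blast
  have pow: "g [^]\<^bsub>G\<lparr>carrier := M c\<rparr>\<^esub> p = g [^] p" for p :: int
    using int_pow_consistent[OF subgroup_M g(1)] by simp
  have "M c \<subseteq> range (\<lambda>p::int. g [^]\<^bsub>G\<lparr>carrier := M c\<rparr>\<^esub> p)"
    using g(2) unfolding pow by blast
  moreover have "range (\<lambda>p::int. g [^]\<^bsub>G\<lparr>carrier := M c\<rparr>\<^esub> p) \<subseteq> M c"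
    using H.int_pow_closed g(1) by auto
  ultimately show ?thesis
    unfolding H.cyclic_group using g(1) by auto
qed

lemma UN_M: "(\<Union>c\<in>mc_index k. M c) = carrier G"
proof
  show "(\<Union>c\<in>mc_index k. M c) \<subseteq> carrier G"
    by (auto simp: M_def)
  show "carrier G \<subseteq> (\<Union>c\<in>mc_index k. M c)"
    using ex_mc_coords[of k] unfolding carrier_eq M_def by blast
qed

text \<open>A generator lies in some \<open>M c\<close> because these sets cover the group, and
  \<open>M c\<close> is closed under powers.\<close>

lemma ex_M_of_cyclic:
  assumes H: "subgroup H G" "cyclic_group (G\<lparr>carrier := H\<rparr>)"
  shows "\<exists>c\<in>mc_index k. H \<subseteq> M c"
proof -
  interpret H: group "G\<lparr>carrier := H\<rparr>"
    by (rule subgroup_imp_group[OF H(1)])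
  obtain g where g: "g \<in> H" "H = range (\<lambda>p::int. g [^]\<^bsub>G\<lparr>carrier := H\<rparr>\<^esub> p)"
    using H(2) unfolding H.cyclic_group by auto
  have "g \<in> carrier G"
    using subgroup.subset[OF H(1)] g(1) by blast
  then obtain c where c: "c \<in> mc_index k" "g \<in> M c"
    using UN_M by blast
  have "g [^] p \<in> M c" for p :: int
    using int_pow_consistent[OF subgroup_M c(2), of p]
      group.int_pow_closed[OF subgroup_imp_group[OF subgroup_M], of g c p] c(2) by simp
  then have "H \<subseteq> M c"
    using g(2) unfolding int_pow_consistent[OF H(1) g(1), symmetric] by auto
  then show ?thesis using c(1) by blast
qed

lemma adjacent_iff:
  "(\<exists>H. subgroup H G \<and> cyclic_group (G\<lparr>carrier := H\<rparr>) \<and> x \<in> H \<and> y \<in> H)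
    \<longleftrightarrow> (\<exists>c\<in>mc_index k. x \<in> M c \<and> y \<in> M c)"
proof
  assume "\<exists>H. subgroup H G \<and> cyclic_group (G\<lparr>carrier := H\<rparr>) \<and> x \<in> H \<and> y \<in> H"
  then show "\<exists>c\<in>mc_index k. x \<in> M c \<and> y \<in> M c"
    using ex_M_of_cyclic by blast
qed (use subgroup_M cyclic_group_M in blast)

lemma bij_betw_elt: "bij_betw (case_prod elt) ({0..<2 * int n} \<times> {0..<3}) (carrier G)"
proof -
  have "inj_on (case_prod elt) ({0..<2 * int n} \<times> {0..<3})"
  proof (rule inj_onI, clarsimp)
    fix i j i' j' assume *: "elt i j = elt i' j'" "0 \<le> i" "i < 2 * int n" "0 \<le> j" "j < 3"
      "0 \<le> i'" "i' < 2 * int n" "0 \<le> j'" "j' < 3"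
    then have "i mod (2 * int n) = i' mod (2 * int n)" "j mod 3 = j' mod 3"
      unfolding elt_eq_iff mod_eq_dvd_iff by auto
    then show "i = i' \<and> j = j'" using * by simp
  qed
  moreover have "carrier G \<subseteq> case_prod elt ` ({0..<2 * int n} \<times> {0..<3})"
  proof
    fix x assume "x \<in> carrier G"
    then obtain i j where "x = elt i j" by (auto simp: carrier_eq)
    also have "\<dots> = elt (i mod (2 * int n)) (j mod 3)"
      by (simp add: elt_eq_iff mod_eq_dvd_iff[symmetric])
    finally show "x \<in> case_prod elt ` ({0..<2 * int n} \<times> {0..<3})"
      using n_pos by force
  qed
  ultimately show ?thesis
    by (auto simp: bij_betw_def)
qed

lemma card_carrier: "card (carrier G) = 6 * n"
  using bij_betw_same_card[OF bij_betw_elt] by (simp add: card_cartesian_product)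

lemma finite_carrier: "finite (carrier G)"
  using bij_betw_finite[OF bij_betw_elt] by simp

lemma ex_M_not_K:
  assumes "c \<in> mc_index k"
  shows "\<exists>x\<in>M c. x \<notin> K"
  using assms
proof (cases rule: mc_index_cases)
  case (Axis h)
  have "elt 1 h \<in> M c" "elt 1 h \<notin> K"
    unfolding elt_in_M[OF assms] elt_in_K by (auto simp: Axis)
  then show ?thesis by blast
next
  case (Skew s d)
  \<comment> \<open>The factor 4 is even and 1 modulo 3.\<close>
  have "elt (4 * d * 3 ^ s) 1 \<in> M c" "elt (4 * d * 3 ^ s) 1 \<notin> K"
    unfolding elt_in_M[OF assms] elt_in_K by (auto simp: Skew)
  then show ?thesis by blast
next
  case Flat
  have "elt 0 1 \<in> M c" "elt 0 1 \<notin> K"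
    unfolding elt_in_M[OF assms] elt_in_K by (auto simp: Flat)
  then show ?thesis by blast
qed

lemma K_subset_M_Axis: "h \<in> {0, 1, 2} \<Longrightarrow> K \<subseteq> M (Axis h)"
  by (auto simp: K_def elt_in_M)

lemma one_in_M: "\<one> \<in> M c"
  using subgroup.one_closed[OF subgroup_M] .

text \<open>All three \<open>Axis\<close> subgroups contain the centre, so \<open>Axis 0\<close> can
  serve as \<open>c0\<close> and \<open>Axis 1\<close> as the further clique through a central
  element.\<close>

sublocale cc: clique_cover \<Gamma> "mc_index k" M K \<one> "Axis 0"
proof
  show "parcs \<Gamma> = {(x, y). x \<noteq> y \<and> (\<exists>c\<in>mc_index k. x \<in> M c \<and> y \<in> M c)}"
    unfolding enhanced_power_graph_def adjacent_iff by simp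
next
  fix c d x assume *: "c \<in> mc_index k" "d \<in> mc_index k" "x \<in> M c" "x \<in> M d" "x \<notin> K"
  then obtain i j where "x = elt i j" by (auto simp: M_def)
  then show "c = d"
    using * mc_coords_unique[of c k d i j] by (simp add: elt_in_M elt_in_K)
next
  fix x assume "x \<in> K"
  then show "\<exists>c\<in>mc_index k. c \<noteq> Axis 0 \<and> x \<in> M c"
    using K_subset_M_Axis[of 1] by (intro bexI[of _ "Axis 1"]) auto
qed (use finite_carrier finite_mc_index UN_M ex_M_not_K one_in_M K_subset_M_Axis
      in \<open>auto simp: enhanced_power_graph_def\<close>)

section \<open>Orders of the maximal cyclic subgroups\<close>

lemma card_M_Axis:
  assumes "h \<in> {0, 1, 2}"
  shows "card (M (Axis h)) = 2 * n"
proof -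
  let ?f = "\<lambda>i. elt i (if even i then 0 else h)"
  have "inj_on ?f {0..<2 * int n}"
  proof (rule inj_onI)
    fix i i' assume *: "?f i = ?f i'" "i \<in> {0..<2 * int n}" "i' \<in> {0..<2 * int n}"
    then have "i mod (2 * int n) = i' mod (2 * int n)"
      unfolding elt_eq_iff mod_eq_dvd_iff by blast
    then show "i = i'" using * by simp
  qed
  moreover have "M (Axis h) = ?f ` {0..<2 * int n}"
  proof
    show "?f ` {0..<2 * int n} \<subseteq> M (Axis h)"
      using assms by (auto simp: elt_in_M)
    show "M (Axis h) \<subseteq> ?f ` {0..<2 * int n}"
    proof
      fix x assume "x \<in> M (Axis h)"
      then obtain i j where x: "x = elt i j" "if even i then 3 dvd j else 3 dvd j - h"
        by (auto simp: M_def)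
      have "even (i mod (2 * int n)) \<longleftrightarrow> even i"
        by (simp add: dvd_mod_iff)
      then have "x = ?f (i mod (2 * int n))"
        using x by (auto simp: elt_eq_iff mod_eq_dvd_iff[symmetric] split: if_splits)
      then show "x \<in> ?f ` {0..<2 * int n}"
        using n_pos by (intro image_eqI) auto
    qed
  qed
  ultimately show ?thesis
    by (simp add: card_image)
qed

text \<open>The element gives back \<open>j\<close> first and then \<open>r\<close>, whatever the
  slope \<open>u\<close>. The slope is 0 for \<open>Flat\<close> and \<open>- 2 * d * 3 ^ s\<close>
  for \<open>Skew s d\<close>.\<close>

lemma inj_on_Skew_param:
  "inj_on (\<lambda>(r, j). elt (2 * 3 ^ k * r + u * j) j) ({0..<int t} \<times> {0..<3})"
proof (rule inj_onI, clarify)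
  fix r j r' j' :: int
  assume *: "elt (2 * 3 ^ k * r + u * j) j = elt (2 * 3 ^ k * r' + u * j') j'"
    and r: "r \<in> {0..<int t}" "r' \<in> {0..<int t}" and j: "j \<in> {0..<3}" "j' \<in> {0..<3}"
  then have "j mod 3 = j' mod 3"
    unfolding elt_eq_iff mod_eq_dvd_iff by blast
  then have "j = j'" using j by simp
  then have "2 * int n dvd 2 * 3 ^ k * r + u * j - (2 * 3 ^ k * r' + u * j)"
    using * unfolding elt_eq_iff by blast
  then have "2 * 3 ^ k * int t dvd 2 * 3 ^ k * (r - r')"
    by (simp add: n_eq algebra_simps)
  then have "r mod int t = r' mod int t"
    unfolding mod_eq_dvd_iff by simp
  then show "r = r' \<and> j = j'" using r \<open>j = j'\<close> by simp
qed

text \<open>A lower bound is enough, since \<open>Flat\<close> already has order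
  \<open>3 * t\<close>.\<close>

lemma card_M_Skew_ge:
  assumes "Skew s d \<in> mc_index k"
  shows "3 * t \<le> card (M (Skew s d))"
proof -
  let ?f = "\<lambda>(r, j). elt (2 * 3 ^ k * r + (- 2 * d * 3 ^ s) * j) j"
  have "3 ^ Suc s dvd (3::int) ^ k"
    using assms by (intro le_imp_power_dvd) simp
  then have "mc_coords k (Skew s d) (2 * 3 ^ k * r + (- 2 * d * 3 ^ s) * j) j" for r j
  proof -
    have "3 ^ Suc s dvd 2 * 3 ^ k * r - 3 ^ Suc s * (d * j)"
      using \<open>3 ^ Suc s dvd 3 ^ k\<close> by (intro dvd_diff dvd_mult dvd_mult2) auto
    then show ?thesis by (simp add: algebra_simps)
  qed
  then have "?f ` ({0..<int t} \<times> {0..<3}) \<subseteq> M (Skew s d)"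
    using elt_in_M[OF assms] by auto
  then have "card ({0..<int t} \<times> {0..<3 :: int}) \<le> card (M (Skew s d))"
    using inj_on_Skew_param cc.finite_M[OF assms] by (intro card_inj_on_le)
  then show ?thesis by (simp add: card_cartesian_product)
qed

lemma card_M_Flat: "card (M Flat) = 3 * t"
proof -
  let ?f = "\<lambda>(r, j). elt (2 * 3 ^ k * r + 0 * j) j"
  have "M Flat = ?f ` ({0..<int t} \<times> {0..<3})"
  proof
    show "?f ` ({0..<int t} \<times> {0..<3}) \<subseteq> M Flat"
      by (auto simp: elt_in_M)
    show "M Flat \<subseteq> ?f ` ({0..<int t} \<times> {0..<3})"
    proof
      fix x assume "x \<in> M Flat"
      then obtain i j where x: "x = elt i j" "even i" "3 ^ k dvd i"
        by (auto simp: M_def)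
      then obtain r where "i = 2 * 3 ^ k * r"
        using divides_mult[of 2 i "3 ^ k"] by (auto elim: dvdE)
      then have "x = ?f (r mod int t, j mod 3)"
        using x by (simp add: elt_eq_iff mod_eq_dvd_iff[symmetric] n_eq right_diff_distrib[symmetric])
      then show "x \<in> ?f ` ({0..<int t} \<times> {0..<3})"
        using t_pos by (intro image_eqI[of _ _ "(r mod int t, j mod 3)"]) auto
    qed
  qed
  then show ?thesis
    using inj_on_Skew_param[of 0] by (simp add: card_image card_cartesian_product)
qed

text \<open>The order \<open>2 * n\<close> of \<open>Axis\<close> is least only for
  \<open>k = 0\<close>; for \<open>k > 0\<close> it is at least \<open>3 * t\<close>, the order of
  \<open>Flat\<close>.\<close>

lemma min_card_M: "Min ((\<lambda>c. card (M c)) ` mc_index k) = (if k = 0 then 2 * t else 3 * t)"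
proof (rule Min_eqI)
  fix m assume "m \<in> (\<lambda>c. card (M c)) ` mc_index k"
  then obtain c where c: "c \<in> mc_index k" "m = card (M c)" by blast
  from c(1) show "(if k = 0 then 2 * t else 3 * t) \<le> m"
  proof (cases rule: mc_index_cases)
    case (Axis h)
    have "3 * t \<le> 2 * n" if "k > 0"
    proof -
      have "3 dvd (3::nat) ^ k" using that by simp
      then have "3 \<le> (3::nat) ^ k"
        by (intro dvd_imp_le) auto
      then have "3 * t \<le> 3 ^ k * t" by (intro mult_right_mono) auto
      then show ?thesis unfolding n_eq by linarith
    qed
    then show ?thesis
      using c(2) Axis card_M_Axis n_eq by auto
  next
    case (Skew s d)
    then show ?thesis
      using c card_M_Skew_ge by auto
  next
    case Flat
    then show ?thesis
      using c card_M_Flat by auto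
  qed
next
  show "(if k = 0 then 2 * t else 3 * t) \<in> (\<lambda>c. card (M c)) ` mc_index k"
  proof (cases "k = 0")
    case True
    then show ?thesis
      using card_M_Axis[of 0] n_eq by (intro image_eqI[of _ _ "Axis 0"]) auto
  next
    case False
    then show ?thesis
      using card_M_Flat by (intro image_eqI[of _ _ Flat]) auto
  qed
qed (simp add: finite_mc_index)

section \<open>Closed neighbourhoods of central elements\<close>

definition central_cliques :: "nat \<Rightarrow> max_cyclic set" where
  "central_cliques v = {c \<in> mc_index k. case c of Axis h \<Rightarrow> True | Skew s d \<Rightarrow> s < v | Flat \<Rightarrow> v = k}"

text \<open>With \<open>3 dvd j\<close> the term \<open>d * j * 3 ^ s\<close> vanishes modulo
  \<open>3 ^ Suc s\<close>, so only the capped valuation \<open>v\<close> of \<open>i\<close>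
  matters.\<close>

lemma cliques_at_central:
  assumes "even i" "3 dvd j" "v \<le> k" "\<And>u. u \<le> k \<Longrightarrow> 3 ^ u dvd i \<longleftrightarrow> u \<le> v"
  shows "cc.cliques_at (elt i j) = central_cliques v"
proof -
  have "mc_coords k c i j \<longleftrightarrow> (case c of Axis h \<Rightarrow> True | Skew s d \<Rightarrow> s < v | Flat \<Rightarrow> v = k)"
    if "c \<in> mc_index k" for c
    using that
  proof (cases rule: mc_index_cases)
    case (Skew s d)
    have "3 ^ Suc s dvd d * j * 3 ^ s"
      using assms(2) by (auto simp: dvd_def)
    then have "3 ^ Suc s dvd i - d * j * 3 ^ s \<longleftrightarrow> 3 ^ Suc s dvd i"
      by (metis dvd_diff_left_iff)
    then show ?thesis
      using Skew assms(1) assms(4)[of "Suc s"] by (simp add: Suc_le_eq)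
  qed (use assms in auto)
  then show ?thesis
    unfolding cc.cliques_at_def central_cliques_def using elt_in_M by blast
qed

text \<open>For \<open>v < v'\<close> the subgroup \<open>Skew v 1\<close> tells the two sets
  apart.\<close>

lemma inj_on_central_cliques: "inj_on central_cliques {..k}"
proof -
  have "central_cliques v \<noteq> central_cliques v'" if "v < v'" "v' \<le> k" for v v'
  proof -
    have "Skew v 1 \<in> central_cliques v'" "Skew v 1 \<notin> central_cliques v"
      using that by (auto simp: central_cliques_def)
    then show ?thesis by blast
  qed
  then show ?thesis
    by (intro inj_onI) (metis atMost_iff linorder_neqE_nat)
qed

text \<open>Every capped valuation \<open>v\<close> occurs, at the exponent
  \<open>2 * 3 ^ v\<close>.\<close>

lemma cliques_at_K: "cc.cliques_at ` K = central_cliques ` {..k}"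
proof
  show "cc.cliques_at ` K \<subseteq> central_cliques ` {..k}"
  proof clarify
    fix x assume "x \<in> K"
    then obtain i j where x: "x = elt i j" "even i" "3 dvd j" by (auto simp: K_def)
    obtain v where "v \<le> k" "\<And>u. u \<le> k \<Longrightarrow> 3 ^ u dvd i \<longleftrightarrow> u \<le> v"
      using pow3_level by blast
    then show "cc.cliques_at x \<in> central_cliques ` {..k}"
      using cliques_at_central x by blast
  qed
  show "central_cliques ` {..k} \<subseteq> cc.cliques_at ` K"
  proof clarify
    fix v assume "v \<le> k"
    have "(3::int) ^ u dvd 2 * 3 ^ v \<longleftrightarrow> u \<le> v" for u
    proof -
      have "(3::int) ^ u dvd 2 * 3 ^ v \<longleftrightarrow> 3 ^ u dvd (3::int) ^ v"
        by (rule coprime_dvd_mult_right_iff) simp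
      then show ?thesis by (simp add: dvd_power_iff)
    qed
    then have "cc.cliques_at (elt (2 * 3 ^ v) 0) = central_cliques v"
      using \<open>v \<le> k\<close> by (intro cliques_at_central) auto
    moreover have "elt (2 * 3 ^ v) 0 \<in> K"
      by (simp add: elt_in_K)
    ultimately show "central_cliques v \<in> cc.cliques_at ` K"
      by (metis image_eqI)
  qed
qed

lemma card_cliques_at_K: "card (cc.cliques_at ` K) = k + 1"
  by (simp add: cliques_at_K card_image inj_on_central_cliques)

section \<open>Self-inverse elements and the matching number\<close>

lemma elt_inv_fixed:
  assumes "elt i j = inv (elt i j)"
  shows "int n dvd i" "odd i \<or> 3 dvd j"
proof -
  \<comment> \<open>Inversion negates \<open>j\<close> for even \<open>i\<close> and keeps it for
    odd \<open>i\<close>, so the second condition restricts \<open>j\<close> only in the even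
    case.\<close>
  have *: "2 * int n dvd 2 * i" "3 dvd j + par_sgn i * j"
    using assms unfolding elt_inv elt_eq_iff by simp_all
  then show "int n dvd i" by simp
  show "odd i \<or> 3 dvd j"
    using *(2) by (auto simp: par_sgn_def split: if_splits; presburger)
qed

lemma inv_in_M: "x \<in> M c \<Longrightarrow> inv x \<in> M c"
  using subgroup.m_inv_closed[OF subgroup_M] .

text \<open>An element shares each \<open>M c\<close> containing it with its inverse, so the pairs
  of inverses outside \<open>S\<close> are edges. They extend a perfect matching \<open>B\<close> of
  the exceptional set \<open>S\<close> to the whole graph.\<close>

lemma matching_inv_pairs:
  assumes S: "S \<subseteq> carrier G" "\<And>x. x \<in> S \<Longrightarrow> inv x \<in> S"
      "\<And>x. x \<in> carrier G \<Longrightarrow> x = inv x \<Longrightarrow> x \<in> S"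
    and B: "matching \<Gamma> B" "\<Union>B = S"
  shows "2 * matching_number \<Gamma> = card (carrier G)"
proof -
  let ?A = "(\<lambda>x. {x, inv x}) ` (carrier G - S)"
  have inv_notin: "inv x \<notin> S" if "x \<in> carrier G - S" for x
    using S(2)[of "inv x"] that by auto
  have edge: "\<exists>u v. {x, inv x} = {u, v} \<and> u \<noteq> v \<and> v \<in> cc.nbh u" if x: "x \<in> carrier G - S" for x
  proof -
    obtain c where "c \<in> mc_index k" "x \<in> M c"
      using x UN_M by blast
    then have "inv x \<in> cc.nbh x"
      using inv_in_M by (auto simp: cc.in_nbh_iff)
    moreover have "x \<noteq> inv x" using S(3) x by blast
    ultimately show ?thesis by blast
  qed
  have disj: "disjnt {x, inv x} {y, inv y}"
    if "x \<in> carrier G - S" "y \<in> carrier G - S" "{x, inv x} \<noteq> {y, inv y}" for x y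
  proof -
    have ii: "inv (inv x) = x" "inv (inv y) = y" using that by auto
    have "{x, inv x} = {y, inv y}" if "x = y \<or> x = inv y"
      using that ii by auto
    moreover have "x = y \<or> x = inv y" if "inv x = y \<or> inv x = inv y"
      using that ii by metis
    ultimately show ?thesis
      using that(3) unfolding disjnt_def by blast
  qed
  have disjB: "disjnt {x, inv x} E" if "x \<in> carrier G - S" "E \<in> B" for x E
    using inv_notin[OF that(1)] that B(2) unfolding disjnt_def by blast
  have "matching \<Gamma> (?A \<union> B)"
    unfolding matching_def cc.undirected_edges_eq
  proof
    show "?A \<union> B \<subseteq> {{x, y} |x y. x \<noteq> y \<and> y \<in> cc.nbh x}"
      using edge B(1) unfolding matching_def cc.undirected_edges_eq by blast
    have A: "pairwise disjnt ?A"
      unfolding pairwise_def using disj by blast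
    have B': "pairwise disjnt B"
      using B(1) by (simp add: matching_def)
    have AB: "disjnt E F" if "E \<in> ?A" "F \<in> B" for E F
      using disjB that by blast
    show "pairwise disjnt (?A \<union> B)"
    proof (rule pairwiseI)
      fix E F assume "E \<in> ?A \<union> B" "F \<in> ?A \<union> B" "E \<noteq> F"
      then show "disjnt E F"
        using pairwiseD[OF A, of E F] pairwiseD[OF B', of E F] AB[of E F] disjnt_sym[OF AB[of F E]]
        by (elim UnE) simp_all
    qed
  qed
  moreover have "\<Union>(?A \<union> B) = pverts \<Gamma>"
    using B(2) S(1) by (auto simp: enhanced_power_graph_def)
  ultimately show ?thesis
    using cc.matching_number_perfect by (simp add: enhanced_power_graph_def)
qed

lemma in_nbh_Axis:
  assumes "h \<in> {0, 1, 2}" "x \<in> M (Axis h)" "y \<in> M (Axis h)"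
  shows "y \<in> cc.nbh x"
  using assms unfolding cc.in_nbh_iff by (intro bexI[of _ "Axis h"]) auto

lemma matching_number_gt_1:
  assumes "n > 1"
  shows "matching_number \<Gamma> = 3 * n"
proof -
  \<comment> \<open>The only self-inverse elements are the identity and \<open>a ^ n\<close>, joined
    for odd \<open>n\<close> by \<open>a ^ n b\<close> and \<open>a ^ n b ^ 2\<close>.\<close>
  have fixed: "elt i j = elt 0 0 \<or> (\<exists>h\<in>{0, 1, 2}. elt i j = elt (int n) h \<and> (even n \<longrightarrow> h = 0))"
    if inv: "elt i j = inv (elt i j)" for i j
  proof -
    obtain q where q: "i = int n * q" using elt_inv_fixed(1)[OF inv] ..
    have j: "j mod 3 \<in> {0, 1, 2}" "3 dvd j - j mod 3"
      by (auto simp: mod_eq_dvd_iff[symmetric])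
    show ?thesis
    proof (cases "even q")
      case True
      then have "2 * int n dvd i" using q by auto
      moreover have "3 dvd j"
        using elt_inv_fixed(2)[OF inv] True q by auto
      ultimately show ?thesis by (simp add: elt_eq_iff)
    next
      case False
      then have "2 * int n dvd i - int n"
        using q by (auto simp: algebra_simps elim!: oddE)
      moreover have "3 dvd j" if "even n"
        using elt_inv_fixed(2)[OF inv] that q by auto
      ultimately show ?thesis
        using j by (intro disjI2 bexI[of _ "j mod 3"]) (auto simp: elt_eq_iff)
    qed
  qed
  have n_ndvd: "\<not> 2 * int n dvd int n"
    using assms by (auto dest: zdvd_imp_le)
  have "2 * matching_number \<Gamma> = card (carrier G)"
  proof (cases "even n")
    case True
    let ?S = "{elt 0 0, elt (int n) 0}"
    show ?thesis
    proof (rule matching_inv_pairs[of ?S "{?S}"])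
      show "inv x \<in> ?S" if "x \<in> ?S" for x
        using that by (auto simp: elt_inv elt_eq_iff)
      show "x \<in> ?S" if "x \<in> carrier G" "x = inv x" for x
        using that fixed True unfolding carrier_eq by auto
      have "elt 0 0 \<in> M (Axis 0)" "elt (int n) 0 \<in> M (Axis 0)"
        using True by (simp_all add: elt_in_M)
      then have "elt (int n) 0 \<in> cc.nbh (elt 0 0)"
        by (intro in_nbh_Axis[of 0]) auto
      moreover have "elt 0 0 \<noteq> elt (int n) 0"
        using n_ndvd by (simp add: elt_eq_iff)
      ultimately show "matching \<Gamma> {?S}"
        unfolding matching_def cc.undirected_edges_eq by (auto simp: pairwise_def)
    qed auto
  next
    case False
    \<comment> \<open>The elements \<open>a ^ n b\<close> and \<open>a ^ n b ^ 2\<close> lie in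
      different \<open>Axis\<close> subgroups. The central inverse pair \<open>a ^ 2\<close>,
      \<open>a ^ (- 2)\<close> is split up to provide their partners; \<open>n \<ge> 3\<close> keeps
      the six elements distinct.\<close>
    let ?x0 = "elt 0 0" and ?y0 = "elt (int n) 0" and ?x1 = "elt 2 0" and ?y1 = "elt (int n) 1"
      and ?x2 = "elt (- 2) 0" and ?y2 = "elt (int n) 2"
    let ?S = "{?x0, ?y0, ?x1, ?y1, ?x2, ?y2}"
    have n3: "n \<ge> 3" using assms False by presburger
    have nd: "\<not> 2 * int n dvd 2" "\<not> 2 * int n dvd 4"
      using n3 by (auto dest: zdvd_imp_le)
    show ?thesis
    proof (rule matching_inv_pairs[of ?S "{{?x0, ?y0}, {?x1, ?y1}, {?x2, ?y2}}"])
      show "inv x \<in> ?S" if "x \<in> ?S" for x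
        using that False by (auto simp: elt_inv elt_eq_iff par_sgn_def)
      show "x \<in> ?S" if "x \<in> carrier G" "x = inv x" for x
        using that fixed unfolding carrier_eq by blast
      have "?y0 \<in> cc.nbh ?x0" "?y1 \<in> cc.nbh ?x1" "?y2 \<in> cc.nbh ?x2"
        using False in_nbh_Axis[of 0 ?x0 ?y0] in_nbh_Axis[of 1 ?x1 ?y1] in_nbh_Axis[of 2 ?x2 ?y2]
        by (simp_all add: elt_in_M)
      moreover have "distinct [?x0, ?y0, ?x1, ?y1, ?x2, ?y2]"
      proof -
        have "\<not> 2 * int n dvd u" if "odd u" for u
          using that dvd_mult_left by blast
        then show ?thesis
          using nd False by (simp add: elt_eq_iff)
      qed
      ultimately show "matching \<Gamma> {{?x0, ?y0}, {?x1, ?y1}, {?x2, ?y2}}"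
        unfolding matching_def cc.undirected_edges_eq by (auto simp: pairwise_def disjnt_def)
    qed auto
  qed
  then show ?thesis by (simp add: card_carrier)
qed

text \<open>At most one edge of a matching contains the identity, and \<open>Flat\<close>, of order
  3, provides the only edge that avoids it.\<close>

lemma matching_number_1:
  assumes "n = 1"
  shows "matching_number \<Gamma> = 2"
  unfolding matching_number_def
proof (rule Max_eqI)
  have kt: "k = 0" "t = 1"
    using assms n_eq t_pos by (auto simp: power_eq_1_iff intro: ccontr)
  fix m assume "m \<in> card ` {A. matching \<Gamma> A}"
  then obtain A where A: "matching \<Gamma> A" "m = card A" by blast
  have "E = M Flat - {\<one>}" if E: "E \<in> A" "\<one> \<notin> E" for E
  proof -
    obtain u v where uv: "E = {u, v}" "u \<noteq> v" "v \<in> cc.nbh u"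
      using A(1) E(1) unfolding matching_def cc.undirected_edges_eq by blast
    then obtain c where c: "c \<in> mc_index k" "{u, v} \<subseteq> M c - {\<one>}"
      using E(2) by (auto simp: cc.in_nbh_iff)
    have fin: "finite (M c - {\<one>})"
      using cc.finite_M[OF c(1)] by simp
    have card: "card (M c - {\<one>}) = card (M c) - 1"
      using one_in_M by (simp add: card_Diff_singleton)
    from c(1) show ?thesis
    proof (cases rule: mc_index_cases)
      case (Axis h)
      \<comment> \<open>For \<open>n = 1\<close> an \<open>Axis\<close> has order 2, which leaves
        one element besides the identity and no room for \<open>u\<close> and
        \<open>v\<close>.\<close>
      have "card {u, v} \<le> card (M c - {\<one>})"
        using c(2) fin by (rule card_mono[rotated])
      then show ?thesis
        using uv(2) card card_M_Axis[OF Axis(2)] Axis(1) assms by simp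
    next
      case (Skew s d)
      then show ?thesis using kt by simp
    next
      case Flat
      then have "{u, v} = M c - {\<one>}"
        using c(2) fin uv(2) card card_M_Flat kt by (intro card_subset_eq) auto
      then show ?thesis using uv(1) Flat by simp
    qed
  qed
  then have sub: "A \<subseteq> {E \<in> A. \<one> \<in> E} \<union> {M Flat - {\<one>}}" by blast
  have finA: "finite A" using cc.matching_Union(1)[OF A(1)] .
  have "card {E \<in> A. \<one> \<in> E} \<le> 1"
    using A(1) finA unfolding matching_def pairwise_def disjnt_def
    by (auto simp: card_le_Suc0_iff_eq)
  moreover have "card A \<le> card ({E \<in> A. \<one> \<in> E} \<union> {M Flat - {\<one>}})"
    using sub finA by (intro card_mono) auto
  moreover have "card ({E \<in> A. \<one> \<in> E} \<union> {M Flat - {\<one>}}) \<le> card {E \<in> A. \<one> \<in> E} + card {M Flat - {\<one>}}"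
    by (rule card_Un_le)
  ultimately show "m \<le> 2"
    using A(2) by simp
next
  have k: "k = 0"
    using assms n_eq by (auto simp: power_eq_1_iff intro: ccontr)
  let ?A = "{{elt 0 0, elt 1 0}, {elt 0 1, elt 0 2}}"
  have "elt 1 0 \<in> cc.nbh (elt 0 0)"
    by (intro in_nbh_Axis[of 0]) (auto simp: elt_in_M)
  moreover have "elt 0 2 \<in> cc.nbh (elt 0 1)"
    unfolding cc.in_nbh_iff by (intro bexI[of _ Flat]) (auto simp: elt_in_M)
  moreover have "distinct [elt 0 0, elt 1 0, elt 0 1, elt 0 2]"
    using assms by (simp add: elt_eq_iff)
  ultimately have "matching \<Gamma> ?A" "card ?A = 2"
    unfolding matching_def cc.undirected_edges_eq by (auto simp: pairwise_def disjnt_def doubleton_eq_iff)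
  then show "2 \<in> card ` {A. matching \<Gamma> A}"
    by (metis image_eqI mem_Collect_eq)
qed (use cc.finite_matchings in simp)

end

theorem theorem3p30:
  fixes n k t :: nat
  assumes "n \<ge> 1" and "n = 3 ^ k * t" and "t > 0" and "\<not> 3 dvd t"
  shows "min_degree (enhanced_power_graph (U6n n)) = (if k = 0 then 2 * t - 1 else 3 * t - 1) \<and>
    independence_number (enhanced_power_graph (U6n n)) = 2 * k + 4 \<and>
    (n > 1 \<longrightarrow> matching_number (enhanced_power_graph (U6n n)) = 3 * n) \<and>
    matching_number (enhanced_power_graph (U6n 1)) = 2 \<and>
    strong_metric_dimension (enhanced_power_graph (U6n n)) = 6 * n - k - 2"
proof -
  interpret U: U6n_group_factored "U6n n" n "word_class n [(Gen_a, True)]"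
    "word_class n [(Gen_b, True)]" k t
    using U6n_group_full_U6n[OF assms(1)] assms
    by (simp add: U6n_group_factored_def U6n_group_factored_axioms_def)
  \<comment> \<open>The claim about \<open>U6n 1\<close> does not depend on \<open>n\<close>, so it
    takes its own instance with \<open>k = 0\<close> and \<open>t = 1\<close>.\<close>
  interpret U1: U6n_group_factored "U6n 1" 1 "word_class 1 [(Gen_a, True)]"
    "word_class 1 [(Gen_b, True)]" 0 1
    using U6n_group_full_U6n[of 1]
    by (simp add: U6n_group_factored_def U6n_group_factored_axioms_def)
  have "card (pverts (enhanced_power_graph (U6n n))) = 6 * n"
    by (simp add: enhanced_power_graph_def U.card_carrier)
  then show ?thesis
    using U.cc.min_degree_eq U.min_card_M U.cc.independence_number_eq card_mc_index
      U.matching_number_gt_1 U1.matching_number_1 U.cc.strong_metric_dimension_eq U.card_cliques_at_K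
    by simp
qed

end
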